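(* Let $\Bbbk$ be a field of characteristic zero, let $n\geq 2$ be an integer and let $a,a'\in\Bbbk$. The following are equivalent: (1) $a=a'$; (2) $R(n,a)\cong R(n,a')$ (as $\Bbbk$-algebras); (3) $A(n,a)$ is Poisson isomorphic to $A(n,a')$.
   Context: Let $A=\Bbbk[X_0,\dots,X_n]$ be the commutative polynomial ring, $\partial_i=\partial/\partial X_i$, and define the derivations $\Delta=\sum_{i=1}^{n}X_{i-1}\partial_i$ and $\Gamma_a=\sum_{i=0}^n (a+i)X_i\partial_i$ of $A$. For $k\in\mathbb{N}$ put $\binom{\Gamma_a}{k}=\frac{1}{k!}\Gamma_a(\Gamma_a-1)\cdots(\Gamma_a-(k-1))$. Then $R(n,a)$ is the associative $\Bbbk$-algebra with underlying vector space $A$ and multiplication $f\ast g=\sum_{k\ge 0}\Delta^k(f)\binom{\Gamma_a}{k}(g)$, and $A(n,a)$ is the Poisson algebra $A$ with bracket $\{f,g\}_a=\Delta(f)\Gamma_a(g)-\Gamma_a(f)\Delta(g)$. Isomorphisms are not required to be graded. *)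

theory Defs
  imports "HOL-Algebra.Module" "HOL-Algebra.QuotRing" "HOL-Library.Poly_Mapping"
begin

text \<open>
  A monomial is its finitely supported exponent function, and a polynomial is a finitely supported
  function from monomials to coefficients. The type has countably many indeterminates; \<open>polys n\<close> is
  the polynomial ring in the indeterminates of index \<open>0, \<dots>, n\<close>.
\<close>

type_synonym 'k mpoly = "(nat \<Rightarrow>\<^sub>0 nat) \<Rightarrow>\<^sub>0 'k"

definition polys :: "nat \<Rightarrow> 'k::zero mpoly set" where
  "polys n = {p. \<forall>m\<in>Poly_Mapping.keys p. Poly_Mapping.keys m \<subseteq> {0..n}}"

definition const :: "'k::zero \<Rightarrow> 'k mpoly" where
  "const c = Poly_Mapping.single 0 c"

definition indet :: "nat \<Rightarrow> 'k::zero_neq_one mpoly" where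
  "indet i = Poly_Mapping.single (Poly_Mapping.single i 1) 1"

text \<open>
  The subtraction of exponents is truncated, but it only truncates when the exponent of the
  \<open>i\<close>-th indeterminate in \<open>m\<close> is \<open>0\<close>, and then the coefficient is \<open>0\<close>.
\<close>

definition pdiff :: "nat \<Rightarrow> 'k::comm_ring_1 mpoly \<Rightarrow> 'k mpoly" where
  "pdiff i p = (\<Sum>m\<in>Poly_Mapping.keys p.
     Poly_Mapping.single (m - Poly_Mapping.single i 1)
       (of_nat (Poly_Mapping.lookup m i) * Poly_Mapping.lookup p m))"

definition Delta :: "nat \<Rightarrow> 'k::comm_ring_1 mpoly \<Rightarrow> 'k mpoly" where
  "Delta n f = (\<Sum>i=1..n. indet (i - 1) * pdiff i f)"

definition Gamma :: "nat \<Rightarrow> 'k::comm_ring_1 \<Rightarrow> 'k mpoly \<Rightarrow> 'k mpoly" where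
  "Gamma n a f = (\<Sum>i=0..n. const (a + of_nat i) * indet i * pdiff i f)"

text \<open>The composite operator \<open>T \<circ> (T - 1) \<circ> \<dots> \<circ> (T - (k - 1))\<close>.\<close>

primrec ffact_op :: "('k::comm_ring_1 mpoly \<Rightarrow> 'k mpoly) \<Rightarrow> nat \<Rightarrow> 'k mpoly \<Rightarrow> 'k mpoly" where
  "ffact_op T 0 g = g"
| "ffact_op T (Suc k) g = ffact_op T k (T g - of_nat k * g)"

definition binom_op :: "('k::field_char_0 mpoly \<Rightarrow> 'k mpoly) \<Rightarrow> nat \<Rightarrow> 'k mpoly \<Rightarrow> 'k mpoly" where
  "binom_op T k g = const (1 / fact k) * ffact_op T k g"

text \<open>
  \<open>Sum_any\<close> sums a finitely supported family over its whole index type; the family is finitely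
  supported because \<open>Delta n\<close> is locally nilpotent, see \<open>finite_support_star\<close> below.
\<close>

definition star :: "nat \<Rightarrow> 'k::field_char_0 \<Rightarrow> 'k mpoly \<Rightarrow> 'k mpoly \<Rightarrow> 'k mpoly" where
  "star n a f g = Sum_any (\<lambda>k::nat. (Delta n ^^ k) f * binom_op (Gamma n a) k g)"

definition pbracket :: "nat \<Rightarrow> 'k::comm_ring_1 \<Rightarrow> 'k mpoly \<Rightarrow> 'k mpoly \<Rightarrow> 'k mpoly" where
  "pbracket n a f g = Delta n f * Gamma n a g - Gamma n a f * Delta n g"

text \<open>
  The record \<open>module\<close> is only used for its fields (ring operations together with a scalar
  multiplication); algebras need not be commutative here. The scalars are the whole type \<open>'k\<close>.
\<close>

record ('k, 'b) poisson_algebra = "('k, 'b) module" +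
  bracket :: "'b \<Rightarrow> 'b \<Rightarrow> 'b"

definition R_alg :: "nat \<Rightarrow> 'k::field_char_0 \<Rightarrow> ('k, 'k mpoly) module" where
  "R_alg n a =
     \<lparr>carrier = polys n, monoid.mult = star n a, one = 1, zero = 0, add = (+),
      smult = (\<lambda>c f. const c * f)\<rparr>"

definition A_alg :: "nat \<Rightarrow> 'k::field_char_0 \<Rightarrow> ('k, 'k mpoly) poisson_algebra" where
  "A_alg n a =
     \<lparr>carrier = polys n, monoid.mult = (*), one = 1, zero = 0, add = (+),
      smult = (\<lambda>c f. const c * f), bracket = pbracket n a\<rparr>"

definition algebra_iso ::
  "('k, 'b, 'm) module_scheme \<Rightarrow> ('k, 'c, 'n) module_scheme \<Rightarrow> ('b \<Rightarrow> 'c) set" where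
  "algebra_iso R S =
     {h \<in> ring_iso R S. \<forall>c. \<forall>x\<in>carrier R. h (c \<odot>\<^bsub>R\<^esub> x) = c \<odot>\<^bsub>S\<^esub> h x}"

definition algebra_isomorphic ::
  "('k, 'b, 'm) module_scheme \<Rightarrow> ('k, 'c, 'n) module_scheme \<Rightarrow> bool" where
  "algebra_isomorphic R S \<longleftrightarrow> algebra_iso R S \<noteq> {}"

definition poisson_iso ::
  "('k, 'b, 'm) poisson_algebra_scheme \<Rightarrow> ('k, 'c, 'n) poisson_algebra_scheme \<Rightarrow> ('b \<Rightarrow> 'c) set" where
  "poisson_iso P Q =
     {h \<in> algebra_iso P Q.
        \<forall>x\<in>carrier P. \<forall>y\<in>carrier P. h (bracket P x y) = bracket Q (h x) (h y)}"

definition poisson_isomorphic ::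
  "('k, 'b, 'm) poisson_algebra_scheme \<Rightarrow> ('k, 'c, 'n) poisson_algebra_scheme \<Rightarrow> bool" where
  "poisson_isomorphic P Q \<longleftrightarrow> poisson_iso P Q \<noteq> {}"


subsection \<open>The product is well defined\<close>

definition weight :: "nat \<Rightarrow> (nat \<Rightarrow>\<^sub>0 nat) \<Rightarrow> nat" where
  "weight n m = (\<Sum>i=0..n. i * Poly_Mapping.lookup m i)"

lemma weight_add: "weight n (m + m') = weight n m + weight n m'"
  by (simp add: weight_def lookup_add algebra_simps sum.distrib)

lemma weight_single: "i \<le> n \<Longrightarrow> weight n (Poly_Mapping.single i 1) = i"
  by (simp add: weight_def lookup_single when_def if_distrib cong: if_cong)

lemma keys_Delta:
  fixes f :: "'k::comm_ring_1 mpoly"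
  assumes "m \<in> Poly_Mapping.keys (Delta n f)"
  shows "\<exists>l\<in>Poly_Mapping.keys f. weight n m < weight n l"
proof -
  obtain i where i: "i \<in> {1..n}" "m \<in> Poly_Mapping.keys (indet (i - 1) * pdiff i f)"
    using assms keys_sum unfolding Delta_def by fastforce
  then obtain u where u: "m = Poly_Mapping.single (i - 1) 1 + u" "u \<in> Poly_Mapping.keys (pdiff i f)"
    using keys_mult[of "indet (i - 1)" "pdiff i f"] by (auto simp: indet_def)
  then obtain l where l: "l \<in> Poly_Mapping.keys f" "u = l - Poly_Mapping.single i 1"
      "of_nat (Poly_Mapping.lookup l i) * Poly_Mapping.lookup f l \<noteq> 0"
    using keys_sum unfolding pdiff_def by (fastforce split: if_splits)
  have "Poly_Mapping.lookup l i \<noteq> 0"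
    using l(3) by (metis mult_zero_left of_nat_0)
  then have "l = Poly_Mapping.single i 1 + u"
    by (intro poly_mapping_eqI)
      (auto simp: l(2) lookup_add lookup_minus lookup_single when_def)
  then have "weight n l = i + weight n u" "weight n m = i - 1 + weight n u"
    using i(1) u(1) weight_single[of i n] weight_single[of "i - 1" n] by (auto simp: weight_add)
  then show ?thesis
    using i(1) l(1) by (intro bexI[of _ l]) auto
qed

lemma Delta_locally_nilpotent:
  fixes f :: "'k::comm_ring_1 mpoly"
  shows "\<exists>N. \<forall>k\<ge>N. (Delta n ^^ k) f = 0"
proof -
  obtain N where N: "\<And>m. m \<in> Poly_Mapping.keys f \<Longrightarrow> weight n m < N"
    using finite_nat_set_iff_bounded[of "weight n ` Poly_Mapping.keys f"] by auto
  have *: "weight n m + k < N" if "m \<in> Poly_Mapping.keys ((Delta n ^^ k) f)" for m k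
    using that
  proof (induction k arbitrary: m)
    case (Suc k)
    then show ?case using keys_Delta[of m n "(Delta n ^^ k) f"] by fastforce
  qed (simp add: N)
  have "(Delta n ^^ k) f = 0" if "k \<ge> N" for k
  proof -
    have "Poly_Mapping.keys ((Delta n ^^ k) f) = {}"
      using *[of _ k] that by fastforce
    then show ?thesis
      by (intro poly_mapping_eqI) (metis in_keys_iff empty_iff lookup_zero)
  qed
  then show ?thesis by blast
qed

lemma finite_support_star:
  "finite {k. (Delta n ^^ k) f * binom_op (Gamma n a) k g \<noteq> 0}"
proof -
  obtain N where "\<forall>k\<ge>N. (Delta n ^^ k) f = 0"
    using Delta_locally_nilpotent by blast
  then have "{k. (Delta n ^^ k) f * binom_op (Gamma n a) k g \<noteq> 0} \<subseteq> {..<N}"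
    by (auto simp: not_le[symmetric])
  then show ?thesis by (rule finite_subset) simp
qed

end

theory Submission
  imports Defs
begin

text \<open>
  Let \<open>\<phi>\<close> be an isomorphism, for either structure, from parameter \<open>a\<close> to parameter \<open>a'\<close>. Passing to
  the inverse if necessary, assume \<open>a' \<noteq> 0\<close>, and write \<open>Z, F, G\<close> for the images of \<open>X\<^sub>0, X\<^sub>1, X\<^sub>2\<close>.
  As \<open>X\<^sub>0\<close> is normal, so is \<open>Z\<close>; comparing \<open>Z\<close> with \<open>X\<^sub>0\<close> in the target and counting the order of
  nilpotency under \<open>\<Delta>\<close> gives \<open>\<Delta> Z = 0\<close>. The linear part of \<open>\<phi>\<close> at the origin is a derivation along a
  character, so its values on the \<open>n + 1\<close> generators are linearly independent, and the linear part
  of \<open>Z\<close> is a nonzero multiple of \<open>X\<^sub>0\<close>. Let \<open>l\<^sub>i\<close> be the coefficient of \<open>X\<^sub>i\<close> in the image of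
  \<open>X\<^sub>i\<close>. The quadratic terms of the relations between \<open>X\<^sub>0\<close> and \<open>X\<^sub>1, X\<^sub>2\<close> give \<open>a' l\<^sub>1 = a l\<^sub>0\<close> and
  \<open>a' l\<^sub>2 = a l\<^sub>1\<close>, and the coefficient of \<open>X\<^sub>1\<^sup>2\<close> in the relation between \<open>X\<^sub>1\<close> and \<open>X\<^sub>2\<close> gives
  \<open>(a' + 1) l\<^sub>2 = (a + 1) l\<^sub>1\<close>. Hence \<open>l\<^sub>2 = l\<^sub>1 \<noteq> 0\<close> and \<open>a = a'\<close>.
\<close>

section \<open>Derivations of the polynomial ring\<close>

text \<open>Updating a map at a fresh key is the same as adding a term there, so induction over
  updates becomes additive.\<close>

lemma mpoly_induct [case_names zero single add]:
  fixes f :: "'k::comm_monoid_add mpoly"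
  assumes zero: "P 0"
    and single: "\<And>m c. P (Poly_Mapping.single m c)"
    and add: "\<And>f g. P f \<Longrightarrow> P g \<Longrightarrow> P (f + g)"
  shows "P f"
proof (induction f rule: Poly_Mapping.update_induct)
  case const
  show ?case by (rule zero)
next
  case (update f m c)
  have "Poly_Mapping.update m c f = f + Poly_Mapping.single m c"
    using update(1)
    by (intro poly_mapping_eqI) (auto simp: lookup_update lookup_add lookup_single when_def in_keys_iff)
  then show ?case
    using add[OF update(3) single] by simp
qed

section \<open>Constants and partial derivatives\<close>

lemma const_0 [simp]: "const 0 = 0"
  by (simp add: const_def)

lemma const_1 [simp]: "const 1 = 1"
  by (simp add: const_def)

lemma const_add: "const (c + d) = const c + const d"
  by (simp add: const_def single_add)

lemma const_mult: "const (c * d) = const c * const d"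
  by (simp add: const_def mult_single)

lemma const_of_nat: "const (of_nat k) = of_nat k"
  by (simp add: const_def)

lemma const_diff: "const (c - d :: 'k::ring_1) = const c - const d"
  by (simp add: const_def single_diff)

lemma const_eq_0_iff [simp]: "const c = 0 \<longleftrightarrow> c = 0"
  by (metis const_def lookup_single_eq lookup_zero single_zero)

text \<open>The coefficientwise form is free of truncated subtraction: wherever truncation could
  make exponents collide, the factor \<open>lookup l i\<close> is 0.\<close>

lemma lookup_pdiff:
  fixes f :: "'k::comm_ring_1 mpoly"
  shows "Poly_Mapping.lookup (pdiff i f) m =
    of_nat (Poly_Mapping.lookup m i + 1) * Poly_Mapping.lookup f (m + Poly_Mapping.single i 1)"
proof -
  let ?e = "Poly_Mapping.single i (1::nat)"
  have *: "(if l - ?e = m then of_nat (Poly_Mapping.lookup l i) * Poly_Mapping.lookup f l else 0)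
     = (if l = m + ?e then of_nat (Poly_Mapping.lookup l i) * Poly_Mapping.lookup f l else 0)" for l
  proof (cases "Poly_Mapping.lookup l i = 0")
    case True
    then show ?thesis by simp
  next
    case False
    have "l - ?e = m \<longleftrightarrow> l = m + ?e"
    proof
      assume "l - ?e = m"
      then show "l = m + ?e"
        using False
        by (intro poly_mapping_eqI) (auto simp: lookup_add lookup_minus lookup_single when_def)
    qed (auto intro!: poly_mapping_eqI simp: lookup_add lookup_minus lookup_single when_def)
    then show ?thesis by simp
  qed
  show ?thesis
    unfolding pdiff_def
    by (simp add: lookup_sum lookup_single when_def * lookup_add in_keys_iff del: One_nat_def cong: if_cong)
qed

lemma pdiff_add: "pdiff i (f + g) = pdiff i f + pdiff i g"
  by (intro poly_mapping_eqI) (simp add: lookup_pdiff lookup_add algebra_simps)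

lemma pdiff_0 [simp]: "pdiff i 0 = 0"
  by (simp add: pdiff_def)

lemma pdiff_single:
  "pdiff i (Poly_Mapping.single m c) =
    Poly_Mapping.single (m - Poly_Mapping.single i 1) (of_nat (Poly_Mapping.lookup m i) * c)"
  by (cases "c = 0") (simp_all add: pdiff_def)

lemma pdiff_const [simp]: "pdiff i (const c) = 0"
  by (simp add: const_def pdiff_single)

lemma pdiff_indet: "pdiff i (indet j) = (if i = j then 1 else 0)"
  by (auto simp: indet_def pdiff_single lookup_single)

text \<open>Both sides are additive in each argument, so monomials suffice. The exponent identities
  \<open>left\<close> and \<open>right\<close> need a positive exponent at \<open>i\<close>; where
  it is 0, the term has coefficient 0.\<close>

lemma pdiff_mult:
  fixes f g :: "'k::comm_ring_1 mpoly"
  shows "pdiff i (f * g) = pdiff i f * g + f * pdiff i g"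
proof (induction f rule: mpoly_induct)
  case (single m c)
  show ?case
  proof (induction g rule: mpoly_induct)
    case (single m' c')
    let ?e = "Poly_Mapping.single i (1::nat)"
    have left: "m' + (m - ?e) = m + m' - ?e" if "Poly_Mapping.lookup m i \<noteq> 0"
      using that by (intro poly_mapping_eqI) (auto simp: lookup_add lookup_minus lookup_single when_def)
    have right: "m + (m' - ?e) = m + m' - ?e" if "Poly_Mapping.lookup m' i \<noteq> 0"
      using that by (intro poly_mapping_eqI) (auto simp: lookup_add lookup_minus lookup_single when_def)
    show ?case
      by (cases "Poly_Mapping.lookup m i = 0"; cases "Poly_Mapping.lookup m' i = 0")
        (simp_all add: pdiff_single mult_single lookup_add left right algebra_simps del: One_nat_def flip: single_add)
  qed (simp_all add: pdiff_add algebra_simps)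
qed (simp_all add: pdiff_add algebra_simps)

lemma pdiff_commute:
  fixes f :: "'k::comm_ring_1 mpoly"
  shows "pdiff i (pdiff j f) = pdiff j (pdiff i f)"
proof (cases "i = j")
  case False
  then show ?thesis
    by (intro poly_mapping_eqI) (simp add: lookup_pdiff lookup_add lookup_single algebra_simps)
qed simp

section \<open>Derivations over the coefficients, their iterates and orders of nilpotency\<close>

locale mpoly_derivation =
  fixes D :: "'k::comm_ring_1 mpoly \<Rightarrow> 'k mpoly"
  assumes add: "D (f + g) = D f + D g"
    and mult: "D (f * g) = D f * g + f * D g"
    and const [simp]: "D (const c) = 0"
begin

lemma zero [simp]: "D 0 = 0"
  using const[of 0] by simp

lemma one [simp]: "D 1 = 0"
  using const[of 1] by simp

lemma const_times [simp]: "D (const c * f) = const c * D f"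
  by (simp add: mult)

lemma diff: "D (f - g) = D f - D g"
  using add[of "f - g" g] by (simp add: algebra_simps)

lemma sum: "D (\<Sum>i\<in>I. f i) = (\<Sum>i\<in>I. D (f i))"
  by (induction I rule: infinite_finite_induct) (simp_all add: add)

lemma of_nat [simp]: "D (of_nat k) = 0"
  using const[of "of_nat k"] by (simp only: const_of_nat)

lemma of_nat_times: "D (of_nat k * f) = of_nat k * D f"
  by (simp add: mult)

lemma funpow_zero [simp]: "(D ^^ k) 0 = 0"
  by (induction k) simp_all

lemma funpow_add: "(D ^^ k) (f + g) = (D ^^ k) f + (D ^^ k) g"
  by (induction k) (simp_all add: add)

lemma funpow_diff: "(D ^^ k) (f - g) = (D ^^ k) f - (D ^^ k) g"
  by (induction k) (simp_all add: diff)

lemma funpow_sum: "(D ^^ k) (\<Sum>i\<in>I. f i) = (\<Sum>i\<in>I. (D ^^ k) (f i))"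
  by (induction k) (simp_all add: sum)

lemma funpow_const_times: "(D ^^ k) (const c * f) = const c * (D ^^ k) f"
  by (induction k) simp_all

lemma funpow_eq_0_mono: "(D ^^ k) f = 0 \<Longrightarrow> k \<le> l \<Longrightarrow> (D ^^ l) f = 0"
  by (metis Nat.le_imp_diff_is_add comp_apply funpow_zero Nat.funpow_add)

lemma Leibniz:
  "(D ^^ k) (f * g) = (\<Sum>i\<le>k. of_nat (k choose i) * (D ^^ i) f * (D ^^ (k - i)) g)"
proof (induction k)
  case (Suc k)
  have "(D ^^ Suc k) (f * g) = (\<Sum>i\<le>k. of_nat (k choose i) * (D ^^ Suc i) f * (D ^^ (k - i)) g) +
      (\<Sum>i\<le>k. of_nat (k choose i) * (D ^^ i) f * (D ^^ (Suc k - i)) g)"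
  proof -
    have "(D ^^ Suc k) (f * g) =
        (\<Sum>i\<le>k. of_nat (k choose i) * ((D ^^ Suc i) f * (D ^^ (k - i)) g + (D ^^ i) f * (D ^^ Suc (k - i)) g))"
      by (simp add: Suc.IH sum mult of_nat_times mult.assoc)
    then show ?thesis
      by (simp add: Suc_diff_le distrib_left sum.distrib mult.assoc)
  qed
  \<comment> \<open>The added term \<open>i = Suc k\<close> has binomial coefficient 0. After an
    index shift the two sums align and combine by Pascal's rule.\<close>
  also have "(\<Sum>i\<le>k. of_nat (k choose i) * (D ^^ i) f * (D ^^ (Suc k - i)) g) =
      (\<Sum>i\<le>Suc k. of_nat (k choose i) * (D ^^ i) f * (D ^^ (Suc k - i)) g)"
    by (simp add: binomial_eq_0)
  also have "\<dots> = f * (D ^^ Suc k) g + (\<Sum>i\<le>k. of_nat (k choose Suc i) * (D ^^ Suc i) f * (D ^^ (k - i)) g)"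
    by (subst sum.atMost_Suc_shift) simp
  also have "(\<Sum>i\<le>k. of_nat (k choose i) * (D ^^ Suc i) f * (D ^^ (k - i)) g) + \<dots> =
      f * (D ^^ Suc k) g + (\<Sum>i\<le>k. of_nat (Suc k choose Suc i) * (D ^^ Suc i) f * (D ^^ (k - i)) g)"
    by (simp add: sum.distrib algebra_simps)
  also have "\<dots> = (\<Sum>i\<le>Suc k. of_nat (Suc k choose i) * (D ^^ i) f * (D ^^ (Suc k - i)) g)"
    by (subst sum.atMost_Suc_shift) simp
  finally show ?case .
qed simp

lemma funpow_times:
  assumes "D f = 0"
  shows "(D ^^ k) (f * g) = f * (D ^^ k) g"
  by (induction k) (simp_all add: mult assms)

text \<open>Pigeonhole: each Leibniz term has \<open>p \<le> i\<close> or
  \<open>q \<le> k - i\<close>.\<close>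

lemma funpow_mult_eq_0:
  assumes "(D ^^ p) f = 0" "(D ^^ q) g = 0" "p + q \<le> Suc k"
  shows "(D ^^ k) (f * g) = 0"
proof -
  have "(D ^^ i) f * (D ^^ (k - i)) g = 0" if "i \<le> k" for i
  proof (cases "p \<le> i")
    case True
    then show ?thesis using funpow_eq_0_mono[OF assms(1)] by simp
  next
    case False
    then have "q \<le> k - i" using assms(3) that by simp
    then show ?thesis using funpow_eq_0_mono[OF assms(2)] by simp
  qed
  then show ?thesis by (simp add: Leibniz mult.assoc)
qed

text \<open>Only the Leibniz term \<open>i = p\<close> survives. Over a field of characteristic zero
  this makes orders of nilpotency additive on products, which drives the counting arguments
  below.\<close>

lemma funpow_mult_top:
  assumes "(D ^^ Suc p) f = 0" "(D ^^ Suc q) g = 0"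
  shows "(D ^^ (p + q)) (f * g) = of_nat ((p + q) choose p) * (D ^^ p) f * (D ^^ q) g"
proof -
  have "of_nat ((p + q) choose i) * (D ^^ i) f * (D ^^ (p + q - i)) g = 0"
    if "i \<in> {..p + q} - {p}" for i
  proof (cases "p < i")
    case True
    then show ?thesis using funpow_eq_0_mono[OF assms(1), of i] by simp
  next
    case False
    then have "Suc q \<le> p + q - i" using that by auto
    then show ?thesis using funpow_eq_0_mono[OF assms(2)] by simp
  qed
  then have "(D ^^ (p + q)) (f * g) =
      (\<Sum>i\<in>{p}. of_nat ((p + q) choose i) * (D ^^ i) f * (D ^^ (p + q - i)) g)"
    unfolding Leibniz by (intro sum.mono_neutral_right) auto
  then show ?thesis by simp
qed

end

section \<open>The derivations \<open>Delta\<close> and \<open>Gamma\<close> and their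
  commutators\<close>

interpretation pdiff: mpoly_derivation "pdiff i" for i
  by unfold_locales (simp_all add: pdiff_add pdiff_mult)

interpretation Delta: mpoly_derivation "Delta n" for n
  by unfold_locales
    (simp_all add: Delta_def pdiff_add pdiff_mult algebra_simps sum.distrib sum_distrib_left)

interpretation Gamma: mpoly_derivation "Gamma n a" for n a
  by unfold_locales
    (simp_all add: Gamma_def pdiff_add pdiff_mult algebra_simps sum.distrib sum_distrib_left)

lemma Delta_indet:
  "Delta n (indet i :: 'k::comm_ring_1 mpoly) = (if i \<in> {1..n} then indet (i - 1) else 0)"
  by (simp add: Delta_def pdiff_indet if_distrib[of "\<lambda>x. _ * x"] cong: if_cong)

lemma Delta_indet_0 [simp]: "Delta n (indet 0) = 0"
  by (simp add: Delta_indet)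

lemma Gamma_indet:
  "i \<le> n \<Longrightarrow> Gamma n a (indet i) = const (a + of_nat i) * indet i"
  by (simp add: Gamma_def pdiff_indet if_distrib[of "\<lambda>x. _ * x"] cong: if_cong)

text \<open>The commutator comes from differentiating the coefficient \<open>indet (j - 1)\<close>,
  which is nonzero only for \<open>j = Suc i\<close>.\<close>

lemma pdiff_Delta:
  "pdiff i (Delta n f) = Delta n (pdiff i f) + (if i < n then pdiff (Suc i) f else 0)"
proof -
  have "(\<Sum>j=1..n. pdiff i (indet (j - 1)) * pdiff j f) = (if i < n then pdiff (Suc i) f else 0)"
  proof -
    have "(\<Sum>j=1..n. pdiff i (indet (j - 1)) * pdiff j f) =
        (\<Sum>j=1..n. if j = Suc i then pdiff (Suc i) f else 0)"
      by (intro sum.cong) (auto simp: pdiff_indet)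
    then show ?thesis by simp
  qed
  then show ?thesis
    by (simp add: Delta_def pdiff.sum pdiff_mult sum.distrib pdiff_commute[of i])
qed

lemma pdiff_Gamma:
  assumes "i \<le> n"
  shows "pdiff i (Gamma n a f) = Gamma n a (pdiff i f) + const (a + of_nat i) * pdiff i f"
proof -
  have "(\<Sum>j=0..n. const (a + of_nat j) * pdiff i (indet j) * pdiff j f) =
      (\<Sum>j=0..n. if j = i then const (a + of_nat i) * pdiff i f else 0)"
    by (intro sum.cong) (auto simp: pdiff_indet)
  then show ?thesis
    using assms
    by (simp add: Gamma_def pdiff.sum pdiff_mult sum.distrib pdiff_commute[of i] algebra_simps)
qed

text \<open>\<open>Gamma\<close> scales \<open>indet i\<close> by \<open>a + i\<close> and
  \<open>Delta\<close> lowers the index by one, so the commutator of the two is \<open>Delta\<close>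
  itself.\<close>

lemma Delta_Gamma: "Delta n (Gamma n a f) = Gamma n a (Delta n f) + Delta n f"
proof -
  define c :: "nat \<Rightarrow> 'a mpoly" where "c i = const (a + of_nat i)" for i
  have c_Suc: "c (Suc i) = c i + 1" for i
    by (simp add: c_def const_add algebra_simps)
  have shift: "(\<Sum>i=0..n. if i < n then g (Suc i) else 0) = (\<Sum>i=1..n. g i)" for g :: "nat \<Rightarrow> 'a mpoly"
  proof -
    have "(\<Sum>i=0..n. if i < n then g (Suc i) else 0) = (\<Sum>i\<in>{0..<n}. g (Suc i))"
      by (intro sum.mono_neutral_cong_right) auto
    also have "\<dots> = (\<Sum>i=1..n. g i)"
      by (simp add: sum.shift_bounds_Suc_ivl[symmetric] atLeastLessThanSuc_atLeastAtMost)
    finally show ?thesis .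
  qed
  have zero: "(\<Sum>i=0..n. g i) = g 0 + (\<Sum>i=1..n. g i)" for g :: "nat \<Rightarrow> 'a mpoly"
    by (simp add: sum.atLeast_Suc_atMost)
  \<comment> \<open>The summand is written with \<open>Suc i - 1\<close> so that
    \<open>shift\<close> can reindex it.\<close>
  have "Gamma n a (Delta n f) =
      (\<Sum>i=0..n. c i * indet i * Delta n (pdiff i f)) +
      (\<Sum>i=0..n. if i < n then c (Suc i - 1) * indet (Suc i - 1) * pdiff (Suc i) f else 0)"
    unfolding Gamma_def c_def[symmetric] pdiff_Delta sum.distrib[symmetric]
    by (intro sum.cong) (auto simp: algebra_simps)
  also have "\<dots> = (\<Sum>i=0..n. c i * indet i * Delta n (pdiff i f)) +
      (\<Sum>i=1..n. c (i - 1) * indet (i - 1) * pdiff i f)"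
    by (subst shift[of "\<lambda>i. c (i - 1) * indet (i - 1) * pdiff i f"]) simp
  finally have 1: "Gamma n a (Delta n f) = \<dots>" .
  have "Delta n (Gamma n a f) =
      (\<Sum>i=0..n. c i * indet i * Delta n (pdiff i f)) + (\<Sum>i=0..n. c i * Delta n (indet i) * pdiff i f)"
    by (simp add: Gamma_def c_def Delta.sum Delta.mult sum.distrib algebra_simps)
  also have "(\<Sum>i=0..n. c i * Delta n (indet i) * pdiff i f) = (\<Sum>i=1..n. c i * indet (i - 1) * pdiff i f)"
    by (subst zero) (simp add: Delta_indet)
  also have "\<dots> = (\<Sum>i=1..n. c (i - 1) * indet (i - 1) * pdiff i f + indet (i - 1) * pdiff i f)"
  proof (intro sum.cong refl)
    fix i assume "i \<in> {1..n}"
    then obtain j where "i = Suc j" by (cases i) auto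
    then show "c i * indet (i - 1) * pdiff i f =
        c (i - 1) * indet (i - 1) * pdiff i f + indet (i - 1) * pdiff i f"
      by (simp add: c_Suc algebra_simps)
  qed
  finally show ?thesis
    unfolding 1 by (simp add: Delta_def sum.distrib)
qed

section \<open>Constant and linear coefficients at the origin\<close>

abbreviation const_coeff :: "'k::zero mpoly \<Rightarrow> 'k" where
  "const_coeff f \<equiv> Poly_Mapping.lookup f 0"

text \<open>A product of monomials is 1 only if both factors are, so evaluation at the origin is
  multiplicative.\<close>

lemma const_coeff_mult [simp]:
  fixes f g :: "'k::comm_ring_1 mpoly"
  shows "const_coeff (f * g) = const_coeff f * const_coeff g"
proof (induction f rule: mpoly_induct)
  case (single m c)
  show ?case
  proof (induction g rule: mpoly_induct)
    case (single m' c')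
    have "m + m' = 0 \<longleftrightarrow> m = 0 \<and> m' = 0"
      by (auto simp: poly_mapping_eq_iff fun_eq_iff lookup_add)
    then show ?case by (simp add: mult_single lookup_single when_def)
  qed (simp_all add: lookup_add algebra_simps)
qed (simp_all add: lookup_add algebra_simps)

lemma const_coeff_const [simp]: "const_coeff (const c) = c"
  by (simp add: const_def)

lemma const_coeff_indet [simp]: "const_coeff (indet i) = 0"
  by (metis (no_types) indet_def lookup_single_not_eq lookup_single_eq lookup_zero one_neq_zero)

lemma const_coeff_Delta [simp]: "const_coeff (Delta n f) = 0"
  by (simp add: Delta_def lookup_sum)

lemma const_coeff_Gamma [simp]: "const_coeff (Gamma n a f) = 0"
  by (simp add: Gamma_def lookup_sum)

text \<open>Encoded as a derivative evaluated at the origin, so that the product rule and the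
  commutator formulas compute it.\<close>

abbreviation lin_coeff :: "nat \<Rightarrow> 'k::comm_ring_1 mpoly \<Rightarrow> 'k" where
  "lin_coeff i f \<equiv> const_coeff (pdiff i f)"

lemma lin_coeff_Delta: "i < n \<Longrightarrow> lin_coeff i (Delta n f) = lin_coeff (Suc i) f"
  by (simp add: pdiff_Delta lookup_add)

lemma lin_coeff_Gamma: "i \<le> n \<Longrightarrow> lin_coeff i (Gamma n a f) = (a + of_nat i) * lin_coeff i f"
  by (simp add: pdiff_Gamma lookup_add)

lemma funpow_Delta_indet:
  "i \<le> n \<Longrightarrow> (Delta n ^^ k) (indet i :: 'k::comm_ring_1 mpoly) = (if k \<le> i then indet (i - k) else 0)"
  by (induction k) (auto simp: Delta_indet)

lemma funpow_Delta_Gamma: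
  "(Delta n ^^ k) (Gamma n a f) = Gamma n a ((Delta n ^^ k) f) + of_nat k * (Delta n ^^ k) f"
  by (induction k) (simp_all add: Delta.add Delta_Gamma Delta.of_nat_times algebra_simps)

text \<open>Euler's identity in each indeterminate: \<open>indet i * pdiff i\<close> multiplies a
  monomial by its exponent at \<open>i\<close>. Hence monomials are eigenvectors of
  \<open>Gamma\<close>.\<close>

lemma Gamma_single:
  "Gamma n a (Poly_Mapping.single m c) =
    const (\<Sum>i=0..n. (a + of_nat i) * of_nat (Poly_Mapping.lookup m i)) * Poly_Mapping.single m c"
proof -
  have *: "indet i * pdiff i (Poly_Mapping.single m c) =
      const (of_nat (Poly_Mapping.lookup m i)) * Poly_Mapping.single m c" for i
  proof (cases "Poly_Mapping.lookup m i = 0")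
    case False
    then have "Poly_Mapping.single i 1 + (m - Poly_Mapping.single i 1) = m"
      by (intro poly_mapping_eqI) (auto simp: lookup_add lookup_minus lookup_single when_def)
    then show ?thesis
      by (simp add: indet_def pdiff_single mult_single const_def del: One_nat_def single_of_nat)
  qed (simp add: pdiff_single)
  have "const (\<Sum>i=0..n. g i) = (\<Sum>i=0..n. const (g i))" for g :: "nat \<Rightarrow> 'a"
    by (induction n) (simp_all add: const_add)
  then show ?thesis
    by (simp add: Gamma_def mult.assoc * const_mult sum_distrib_right)
qed

section \<open>The star product\<close>

lemma binom_op_0 [simp]: "binom_op T 0 g = g"
  by (simp add: binom_op_def)

lemma binom_op_1 [simp]: "binom_op T (Suc 0) g = T g"
  by (simp add: binom_op_def)

text \<open>The scalar \<open>b\<close> varies in the induction because \<open>ffact_op\<close>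
  applies its last factor first, which changes the scalar.\<close>

lemma ffact_op_eigenvector:
  assumes "\<And>b g. T (const b * g) = const b * T g" "T g = const c * g"
  shows "ffact_op T k (const b * g) = const (b * (\<Prod>i<k. c - of_nat i)) * g"
proof (induction k arbitrary: b)
  case (Suc k)
  have "T (const b * g) - of_nat k * (const b * g) = const (b * (c - of_nat k)) * g"
    unfolding assms by (simp add: const_diff const_mult const_of_nat algebra_simps)
  then show ?case
    using Suc[of "b * (c - of_nat k)"] by (simp add: ac_simps)
qed simp

lemma binom_op_eigenvector:
  assumes "Gamma n a g = const c * g"
  shows "binom_op (Gamma n a) k g = const (c gchoose k) * g"
  using ffact_op_eigenvector[of "Gamma n a" g c k 1] assms
  by (simp add: binom_op_def gbinomial_prod_rev atLeast0LessThan mult.assoc[symmetric] const_mult[symmetric])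

text \<open>For \<open>k > 0\<close> the outermost factor is \<open>Gamma\<close>, whose values
  vanish at the origin.\<close>

lemma const_coeff_binom_op [simp]: "k > 0 \<Longrightarrow> const_coeff (binom_op (Gamma n a) k g) = 0"
proof (induction k arbitrary: g)
  case (Suc k)
  have "const_coeff (ffact_op (Gamma n a) (Suc k) g) = 0"
  proof (induction k arbitrary: g)
    case (Suc k)
    then show ?case by (simp only: ffact_op.simps(2)[of _ "Suc k"])
  qed simp
  then show ?case by (simp add: binom_op_def del: ffact_op.simps)
qed simp

text \<open>By the commutation rule, the kernel of each power of \<open>Delta\<close> is stable
  under \<open>Gamma\<close>, hence under polynomials in \<open>Gamma\<close>.\<close>

lemma funpow_Delta_binom_op:
  assumes "(Delta n ^^ p) g = 0"
  shows "(Delta n ^^ p) (binom_op (Gamma n a) k g) = 0"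
proof -
  have "(Delta n ^^ p) (ffact_op (Gamma n a) k g) = 0"
    using assms
  proof (induction k arbitrary: g)
    case (Suc k)
    have "(Delta n ^^ p) (Gamma n a g - of_nat k * g) = 0"
      using Suc.prems Delta.funpow_const_times[of p n "of_nat k" g]
      by (simp add: Delta.funpow_diff funpow_Delta_Gamma const_of_nat)
    then show ?case using Suc.IH by simp
  qed simp
  then show ?thesis by (simp add: binom_op_def Delta.funpow_const_times)
qed

lemma star_eq_sum:
  assumes "(Delta n ^^ K) f = 0"
  shows "star n a f g = (\<Sum>k<K. (Delta n ^^ k) f * binom_op (Gamma n a) k g)"
  unfolding star_def
  by (rule Sum_any.expand_superset) (use Delta.funpow_eq_0_mono[OF assms] in \<open>auto simp: not_le[symmetric]\<close>)

lemma star_kernel: "Delta n f = 0 \<Longrightarrow> star n a f g = f * g"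
  using star_eq_sum[of 1 n f a g] by simp

lemma star_indet:
  assumes "i \<le> n"
  shows "star n a (indet i) g = (\<Sum>k\<le>i. indet (i - k) * binom_op (Gamma n a) k g)"
proof -
  have "star n a (indet i) g = (\<Sum>k<Suc i. (Delta n ^^ k) (indet i) * binom_op (Gamma n a) k g)"
    using assms by (intro star_eq_sum) (simp add: funpow_Delta_indet del: funpow.simps)
  then show ?thesis
    using assms by (simp add: funpow_Delta_indet lessThan_Suc_atMost)
qed

text \<open>Each term with \<open>k > 0\<close> is a product of two polynomials vanishing at the
  origin, so the correction to the ordinary product starts in degree two.\<close>

lemma star_expand:
  obtains E where "star n a f g = f * g + E" "const_coeff E = 0" "\<And>i. lin_coeff i E = 0"
proof -
  obtain N where "\<forall>k\<ge>N. (Delta n ^^ k) f = 0"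
    using Delta_locally_nilpotent by blast
  then have N: "(Delta n ^^ Suc N) f = 0" by (metis le_SucI order_refl)
  define E where "E = (\<Sum>k<N. (Delta n ^^ Suc k) f * binom_op (Gamma n a) (Suc k) g)"
  have "star n a f g = f * g + E"
    unfolding star_eq_sum[OF N] E_def by (subst sum.lessThan_Suc_shift) simp
  moreover have "const_coeff E = 0"
    by (simp add: E_def lookup_sum)
  moreover have "lin_coeff i E = 0" for i
    by (simp add: E_def pdiff.sum lookup_sum pdiff_mult lookup_add)
  ultimately show ?thesis by (rule that)
qed

lemma lin_coeff_star:
  "lin_coeff i (star n a f g) = lin_coeff i f * const_coeff g + const_coeff f * lin_coeff i g"
  by (rule star_expand[of n a f g]) (simp add: lookup_add pdiff_add pdiff_mult)

section \<open>Closure properties of \<open>polys\<close> and induction along the generators\<close>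

lemma polys_0 [simp]: "0 \<in> polys n"
  by (simp add: polys_def)

lemma polys_const [simp]: "const c \<in> polys n"
  by (simp add: polys_def const_def)

lemma polys_1 [simp]: "1 \<in> polys n"
  unfolding const_1[symmetric] by (rule polys_const)

lemma polys_indet [simp]: "i \<le> n \<Longrightarrow> indet i \<in> polys n"
  by (simp add: polys_def indet_def)

lemma polys_add: "f \<in> polys n \<Longrightarrow> g \<in> polys n \<Longrightarrow> f + g \<in> polys n"
  using Poly_Mapping.keys_add[of f g] by (auto simp: polys_def)

lemma polys_mult: "f \<in> polys n \<Longrightarrow> g \<in> polys n \<Longrightarrow> f * g \<in> polys n"
proof -
  assume *: "f \<in> polys n" "g \<in> polys n"
  have "Poly_Mapping.keys m \<subseteq> {0..n}" if m: "m \<in> Poly_Mapping.keys (f * g)" for m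
  proof -
    obtain p q where "m = p + q" "p \<in> Poly_Mapping.keys f" "q \<in> Poly_Mapping.keys g"
      using keys_mult[of f g] m by blast
    then show ?thesis
      using Poly_Mapping.keys_add[of p q] * by (fastforce simp: polys_def)
  qed
  then show ?thesis by (simp add: polys_def)
qed

lemma polys_diff:
  fixes f :: "'k::comm_ring_1 mpoly"
  assumes "f \<in> polys n" "g \<in> polys n"
  shows "f - g \<in> polys n"
proof -
  have "f - g = f + const (- 1) * g"
    using const_diff[of 0 "1::'k"] by simp
  then show ?thesis
    using assms by (simp only: polys_add polys_mult polys_const)
qed

lemma polys_sum: "(\<And>i. i \<in> I \<Longrightarrow> f i \<in> polys n) \<Longrightarrow> (\<Sum>i\<in>I. f i) \<in> polys n"
  by (induction I rule: infinite_finite_induct) (auto intro: polys_add)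

lemma polys_pdiff: "f \<in> polys n \<Longrightarrow> pdiff i f \<in> polys n"
proof -
  assume *: "f \<in> polys n"
  have "Poly_Mapping.keys m \<subseteq> {0..n}" if "m \<in> Poly_Mapping.keys (pdiff i f)" for m
  proof -
    have "m + Poly_Mapping.single i 1 \<in> Poly_Mapping.keys f"
      using that by (auto simp: in_keys_iff lookup_pdiff)
    then have "Poly_Mapping.keys (m + Poly_Mapping.single i 1) \<subseteq> {0..n}"
      using * by (auto simp: polys_def)
    moreover have "Poly_Mapping.keys m \<subseteq> Poly_Mapping.keys (m + Poly_Mapping.single i 1)"
      by (auto simp: in_keys_iff lookup_add)
    ultimately show ?thesis by blast
  qed
  then show ?thesis by (simp add: polys_def)
qed

lemma polys_Delta: "f \<in> polys n \<Longrightarrow> Delta n f \<in> polys n"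
  by (auto simp: Delta_def intro!: polys_sum polys_mult polys_pdiff)

lemma polys_Gamma: "f \<in> polys n \<Longrightarrow> Gamma n a f \<in> polys n"
  by (auto simp: Gamma_def intro!: polys_sum polys_mult polys_pdiff)

lemma polys_funpow_Delta: "f \<in> polys n \<Longrightarrow> (Delta n ^^ k) f \<in> polys n"
  by (induction k) (auto intro: polys_Delta)

lemma polys_binom_op: "f \<in> polys n \<Longrightarrow> binom_op (Gamma n a) k f \<in> polys n"
proof -
  have "ffact_op (Gamma n a) k f \<in> polys n" if "f \<in> polys n" for f
    using that
  proof (induction k arbitrary: f)
    case (Suc k)
    have "(of_nat k :: 'a mpoly) \<in> polys n"
      by (simp add: const_of_nat[symmetric])
    then show ?case
      using Suc by (simp add: polys_diff polys_mult polys_Gamma)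
  qed simp
  then show "f \<in> polys n \<Longrightarrow> binom_op (Gamma n a) k f \<in> polys n"
    by (simp add: binom_op_def polys_mult)
qed

lemma polys_star:
  assumes "f \<in> polys n" "g \<in> polys n"
  shows "star n a f g \<in> polys n"
proof -
  obtain N where "(Delta n ^^ N) f = 0"
    using Delta_locally_nilpotent[of n f] by blast
  then show ?thesis
    using assms by (auto simp: star_eq_sum intro!: polys_sum polys_mult polys_funpow_Delta polys_binom_op)
qed

lemma polys_pbracket: "f \<in> polys n \<Longrightarrow> g \<in> polys n \<Longrightarrow> pbracket n a f g \<in> polys n"
  by (simp add: pbracket_def polys_diff polys_mult polys_Delta polys_Gamma)

text \<open>In the last case the claim is also available for smaller indices, which later absorbs
  the lower terms of a star product. The proof is an induction on total degree with an inner
  induction on the index.\<close>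

lemma polys_induct_monom [consumes 1, case_names one add smult indet]:
  fixes f :: "'k::comm_ring_1 mpoly"
  assumes "f \<in> polys n"
    and one: "P 1"
    and add: "\<And>f g. f \<in> polys n \<Longrightarrow> g \<in> polys n \<Longrightarrow> P f \<Longrightarrow> P g \<Longrightarrow> P (f + g)"
    and smult: "\<And>c f. f \<in> polys n \<Longrightarrow> P f \<Longrightarrow> P (const c * f)"
    and indet: "\<And>i m. i \<le> n \<Longrightarrow> Poly_Mapping.single m (1::'k) \<in> polys n \<Longrightarrow> P (Poly_Mapping.single m 1) \<Longrightarrow>
      (\<And>j. j < i \<Longrightarrow> P (indet j * Poly_Mapping.single m 1)) \<Longrightarrow> P (indet i * Poly_Mapping.single m 1)"
  shows "P f"
proof -
  have mon: "P (Poly_Mapping.single m 1)"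
    if "Poly_Mapping.keys m \<subseteq> {0..n}" "(\<Sum>i=0..n. Poly_Mapping.lookup m i) = d" for m d
    using that
  proof (induction d arbitrary: m)
    case 0
    have "Poly_Mapping.lookup m i = 0" for i
    proof (cases "i \<le> n")
      case True
      then show ?thesis using 0(2) by simp
    next
      case False
      then have "i \<notin> Poly_Mapping.keys m" using 0(1) by auto
      then show ?thesis by (simp add: in_keys_iff)
    qed
    then have "m = 0" by (intro poly_mapping_eqI) simp
    then show ?case using one by simp
  next
    case (Suc d)
    have "(\<Sum>i=0..n. Poly_Mapping.lookup m i) \<noteq> 0" using Suc.prems(2) by simp
    then obtain i where i: "i \<le> n" "Poly_Mapping.lookup m i \<noteq> 0"
      by (auto elim: sum.not_neutral_contains_not_neutral)
    define m' where "m' = m - Poly_Mapping.single i 1"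
    have m: "m = Poly_Mapping.single i 1 + m'"
      using i(2) unfolding m'_def
      by (intro poly_mapping_eqI) (auto simp: lookup_add lookup_minus lookup_single when_def)
    have "Poly_Mapping.keys m' \<subseteq> Poly_Mapping.keys m"
      unfolding m by (auto simp: in_keys_iff lookup_add)
    then have keys: "Poly_Mapping.keys m' \<subseteq> {0..n}"
      using Suc.prems(1) by blast
    have "(\<Sum>j=0..n. Poly_Mapping.lookup m j) = (\<Sum>j=0..n. Poly_Mapping.lookup m' j) + 1"
      using i(1) by (simp add: m lookup_add sum.distrib lookup_single when_def del: One_nat_def)
    then have IH: "P (Poly_Mapping.single m' 1)"
      using Suc.prems(2) by (intro Suc.IH keys) simp
    have "j \<le> n \<Longrightarrow> P (indet j * Poly_Mapping.single m' 1)" for j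
    proof (induction j rule: less_induct)
      case (less j)
      then show ?case
        using keys by - (rule indet[OF _ _ IH less.IH]; auto simp: polys_def)
    qed
    from this[OF i(1)] show ?case
      by (simp add: m indet_def mult_single)
  qed
  define t where "t m = const (Poly_Mapping.lookup f m) * Poly_Mapping.single m 1" for m
  have t: "t m = Poly_Mapping.single m (Poly_Mapping.lookup f m)" for m
    by (simp add: t_def const_def mult_single)
  have sum_t: "(\<Sum>m\<in>Poly_Mapping.keys f. t m) = f"
    by (intro poly_mapping_eqI)
      (simp add: t lookup_sum lookup_single when_def in_keys_iff cong: if_cong)
  have "(\<Sum>m\<in>M. t m) \<in> polys n \<and> P (\<Sum>m\<in>M. t m)"
    if "M \<subseteq> Poly_Mapping.keys f" for M
    using finite_subset[OF that finite_keys] that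
  proof (induction M rule: finite_induct)
    case empty
    \<comment> \<open>Zero is reached as 0 times 1.\<close>
    show ?case using smult[OF polys_1 one, of 0] by simp
  next
    case (insert m M)
    then have keys: "Poly_Mapping.keys m \<subseteq> {0..n}"
      using assms(1) by (auto simp: polys_def)
    then have "Poly_Mapping.single m (1::'k) \<in> polys n"
      by (simp add: polys_def)
    then have "t m \<in> polys n" "P (t m)"
      unfolding t_def using mon[OF keys] by (auto intro: polys_mult smult)
    then show ?case
      using insert by (simp add: polys_add add)
  qed
  from this[OF subset_refl] show ?thesis by (simp only: sum_t)
qed

lemma polys_induct [consumes 1, case_names one add smult indet]:
  fixes f :: "'k::comm_ring_1 mpoly"
  assumes "f \<in> polys n" "P 1"
    and "\<And>f g. f \<in> polys n \<Longrightarrow> g \<in> polys n \<Longrightarrow> P f \<Longrightarrow> P g \<Longrightarrow> P (f + g)"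
    and "\<And>c f. f \<in> polys n \<Longrightarrow> P f \<Longrightarrow> P (const c * f)"
    and "\<And>i f. i \<le> n \<Longrightarrow> f \<in> polys n \<Longrightarrow> P f \<Longrightarrow> P (indet i * f)"
  shows "P f"
  using assms(1) by (induction f rule: polys_induct_monom) (auto intro: assms)

text \<open>The indeterminates generate the algebra under \<open>star\<close>. A monomial
  \<open>x\<close> is a \<open>Gamma\<close> eigenvector, so \<open>star n a (indet i) x\<close> is
  \<open>indet i * x\<close> plus scalar multiples of \<open>indet j * x\<close> with
  \<open>j < i\<close>; this triangular system is solved for \<open>indet i * x\<close>.\<close>

lemma polys_star_induct [consumes 1, case_names one add smult indet]:
  fixes f :: "'k::field_char_0 mpoly"
  assumes "f \<in> polys n" and one: "P 1"
    and add: "\<And>f g. f \<in> polys n \<Longrightarrow> g \<in> polys n \<Longrightarrow> P f \<Longrightarrow> P g \<Longrightarrow> P (f + g)"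
    and smult: "\<And>c f. f \<in> polys n \<Longrightarrow> P f \<Longrightarrow> P (const c * f)"
    and indet: "\<And>i f. i \<le> n \<Longrightarrow> f \<in> polys n \<Longrightarrow> P f \<Longrightarrow> P (star n a (indet i) f)"
  shows "P f"
  using assms(1)
proof (induction f rule: polys_induct_monom)
  case (indet i m)
  define x where "x = (Poly_Mapping.single m 1 :: 'k mpoly)"
  obtain c where c: "Gamma n a x = const c * x"
    using Gamma_single[of n a m 1] unfolding x_def by blast
  have x: "x \<in> polys n" using indet by (simp add: x_def)
  have "star n a (indet i) x = (\<Sum>k\<le>i. const (c gchoose k) * (indet (i - k) * x))"
    using indet(1) by (simp add: star_indet binom_op_eigenvector[OF c] ac_simps)
  also have "\<dots> = indet i * x + (\<Sum>k<i. const (c gchoose Suc k) * (indet (i - Suc k) * x))"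
    by (simp add: sum.atMost_shift)
  finally have eq: "indet i * x =
      star n a (indet i) x + const (- 1) * (\<Sum>k<i. const (c gchoose Suc k) * (indet (i - Suc k) * x))"
    using const_diff[of 0 "1::'k"] by simp
  have sum: "(\<Sum>k<l. const (c gchoose Suc k) * (indet (i - Suc k) * x)) \<in> polys n \<and>
      P (\<Sum>k<l. const (c gchoose Suc k) * (indet (i - Suc k) * x))" if "l \<le> i" for l
    using that
  proof (induction l)
    case 0
    show ?case using smult[OF polys_1 one, of 0] by simp
  next
    case (Suc l)
    then have "P (indet (i - Suc l) * x)" "indet (i - Suc l) * x \<in> polys n"
      using indet x by (auto simp: x_def intro: polys_mult)
    then show ?case
      using Suc by (auto intro!: polys_add polys_mult add smult)
  qed
  have "P (indet i * x)"
    unfolding eq using sum[of i] indet x assms(5)[of i x]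
    by (intro add smult) (auto simp: x_def intro: polys_star polys_mult)
  then show ?case by (simp add: x_def)
qed (auto intro: assms)

section \<open>Linear parts of isomorphisms\<close>

lemma homogeneous_system_nontrivial_solution:
  fixes A :: "'i \<Rightarrow> 'j \<Rightarrow> 'k::field"
  assumes "finite I" "finite J" "card I < card J"
  shows "\<exists>c. (\<exists>j\<in>J. c j \<noteq> 0) \<and> (\<forall>i\<in>I. (\<Sum>j\<in>J. c j * A i j) = 0)"
  using assms
proof (induction I arbitrary: A J rule: finite_induct)
  case empty
  then obtain j where "j \<in> J" by fastforce
  then show ?case by (intro exI[of _ "\<lambda>_. 1"]) auto
next
  case (insert i I)
  show ?case
  proof (cases "\<forall>j\<in>J. A i j = 0")
    case True
    then show ?thesis using insert.IH[of J A] insert.prems insert.hyps by auto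
  next
    case False
    then obtain j where j: "j \<in> J" "A i j \<noteq> 0" by blast
    \<comment> \<open>Row \<open>l\<close> minus the multiple of row \<open>i\<close> that clears
      column \<open>j\<close>.\<close>
    define B where "B l m = A l m - A l j * A i m / A i j" for l m
    have "finite (J - {j})" "card I < card (J - {j})"
      using insert j by auto
    then obtain c where c: "\<exists>m\<in>J - {j}. c m \<noteq> 0" "\<And>l. l \<in> I \<Longrightarrow> (\<Sum>m\<in>J - {j}. c m * B l m) = 0"
      using insert.IH[of "J - {j}" B] by blast
    define s where "s = (\<Sum>m\<in>J - {j}. c m * A i m)"
    \<comment> \<open>Back substitution: the value at \<open>j\<close> is chosen to satisfy equation
      \<open>i\<close>.\<close>
    define d where "d = c(j := - s / A i j)"
    have d: "(\<Sum>m\<in>J. d m * A l m) = - s / A i j * A l j + (\<Sum>m\<in>J - {j}. c m * A l m)" for l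
    proof -
      have "(\<Sum>m\<in>J. d m * A l m) = d j * A l j + (\<Sum>m\<in>J - {j}. d m * A l m)"
        using insert.prems j by (simp add: sum.remove)
      also have "(\<Sum>m\<in>J - {j}. d m * A l m) = (\<Sum>m\<in>J - {j}. c m * A l m)"
        by (intro sum.cong) (auto simp: d_def)
      finally show ?thesis by (simp add: d_def)
    qed
    have "(\<Sum>m\<in>J. d m * A i m) = 0"
      unfolding d using j by (simp add: s_def)
    moreover have "(\<Sum>m\<in>J. d m * A l m) = 0" if "l \<in> I" for l
    proof -
      have "(\<Sum>m\<in>J - {j}. c m * B l m) = (\<Sum>m\<in>J - {j}. c m * A l m) - A l j / A i j * s"
        by (simp add: B_def s_def sum_subtractf sum_distrib_left algebra_simps)
      then show ?thesis unfolding d using c(2)[OF that] by (simp add: algebra_simps)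
    qed
    moreover have "\<exists>m\<in>J. d m \<noteq> 0"
      using c(1) by (auto simp: d_def)
    ultimately show ?thesis by (intro exI[of _ d]) auto
  qed
qed

text \<open>The products are parameters so that \<open>star\<close> and the ordinary product share
  the argument; \<open>induct\<close> says that the indeterminates generate the source. If the
  conclusion failed, a nonzero combination of linear coefficients would vanish on the images of all
  generators. Being a derivation along evaluation at the origin, it would vanish on the whole
  image.\<close>

lemma lin_coeff_image_indet_0:
  fixes \<phi> :: "'k::field mpoly \<Rightarrow> 'k mpoly"
  assumes induct: "\<And>P f. f \<in> polys n \<Longrightarrow> P 1 \<Longrightarrow>
      (\<And>f g. f \<in> polys n \<Longrightarrow> g \<in> polys n \<Longrightarrow> P f \<Longrightarrow> P g \<Longrightarrow> P (f + g)) \<Longrightarrow>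
      (\<And>c f. f \<in> polys n \<Longrightarrow> P f \<Longrightarrow> P (const c * f)) \<Longrightarrow>
      (\<And>i f. i \<le> n \<Longrightarrow> f \<in> polys n \<Longrightarrow> P f \<Longrightarrow> P (mul (indet i) f)) \<Longrightarrow> P f"
    and surj: "polys n \<subseteq> \<phi> ` polys n"
    and one: "\<phi> 1 = 1"
    and add: "\<And>f g. f \<in> polys n \<Longrightarrow> g \<in> polys n \<Longrightarrow> \<phi> (f + g) = \<phi> f + \<phi> g"
    and smult: "\<And>c f. f \<in> polys n \<Longrightarrow> \<phi> (const c * f) = const c * \<phi> f"
    and mult: "\<And>f g. f \<in> polys n \<Longrightarrow> g \<in> polys n \<Longrightarrow> \<phi> (mul f g) = mul' (\<phi> f) (\<phi> g)"
    and lin_coeff: "\<And>i f g. lin_coeff i (mul' f g) =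
      lin_coeff i f * const_coeff g + const_coeff f * lin_coeff i g"
  shows "\<exists>j\<le>n. lin_coeff j (\<phi> (indet 0)) \<noteq> 0"
proof (rule ccontr)
  assume *: "\<not> ?thesis"
  have "card {1..n} < card {0..n}" by simp
  \<comment> \<open>a combination of linear coefficients that vanishes on the images of all generators\<close>
  then obtain c where c: "\<exists>j\<in>{0..n}. c j \<noteq> 0"
      "\<And>i. i \<in> {1..n} \<Longrightarrow> (\<Sum>j=0..n. c j * lin_coeff j (\<phi> (indet i))) = 0"
    using homogeneous_system_nontrivial_solution[of "{1..n}" "{0..n}" "\<lambda>i j. lin_coeff j (\<phi> (indet i))"]
    by blast
  define C where "C f = (\<Sum>j=0..n. c j * lin_coeff j f)" for f
  have C_indet: "C (\<phi> (indet i)) = 0" if "i \<le> n" for i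
    using that c(2)[of i] * by (cases "i = 0") (auto simp: C_def)
  have C_mult: "C (mul' f g) = C f * const_coeff g + const_coeff f * C g" for f g
    by (simp add: C_def lin_coeff sum.distrib sum_distrib_left sum_distrib_right algebra_simps)
  have C_\<phi>: "C (\<phi> f) = 0" if "f \<in> polys n" for f
    using that
  proof (rule induct[where P = "\<lambda>f. C (\<phi> f) = 0"])
    fix f g assume "f \<in> polys n" "g \<in> polys n" "C (\<phi> f) = 0" "C (\<phi> g) = 0"
    then show "C (\<phi> (f + g)) = 0"
      by (simp add: C_def add pdiff_add lookup_add algebra_simps sum.distrib)
  next
    fix b f assume "f \<in> polys n" "C (\<phi> f) = 0"
    moreover have "C (const b * g) = b * C g" for g
      by (simp add: C_def sum_distrib_left mult.left_commute)
    ultimately show "C (\<phi> (const b * f)) = 0"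
      by (simp add: smult)
  next
    fix i f assume "i \<le> n" "f \<in> polys n" "C (\<phi> f) = 0"
    then show "C (\<phi> (mul (indet i) f)) = 0"
      using C_indet by (simp add: mult C_mult)
  qed (use one in \<open>simp add: C_def\<close>)
  \<comment> \<open>By surjectivity \<open>indet j\<close> lies in the image, and \<open>C\<close>
    returns \<open>c j\<close> on it.\<close>
  have "c j = 0" if j: "j \<le> n" for j
  proof -
    obtain f where "f \<in> polys n" "\<phi> f = indet j"
      using surj polys_indet[OF j] by (metis image_iff subsetD)
    then have "C (indet j) = 0" using C_\<phi> by metis
    moreover have "C (indet j) = (\<Sum>i=0..n. if i = j then c j else 0)"
      unfolding C_def by (intro sum.cong) (auto simp: pdiff_indet)
    ultimately show ?thesis using j by simp
  qed
  then show False using c(1) by auto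
qed

section \<open>The kernel of \<open>Delta\<close>\<close>

lemma Delta_order:
  fixes f :: "'k::comm_ring_1 mpoly"
  assumes "f \<noteq> 0"
  obtains N where "(Delta n ^^ N) f \<noteq> 0" "(Delta n ^^ Suc N) f = 0"
proof -
  obtain K where K: "(Delta n ^^ K) f = 0"
    using Delta_locally_nilpotent[of n f] by blast
  have "\<not> (Delta n ^^ 0) f = 0" using assms by simp
  then obtain N where "\<forall>i\<le>N. (Delta n ^^ i) f \<noteq> 0" "(Delta n ^^ Suc N) f = 0"
    using ex_least_nat_less[of "\<lambda>k. (Delta n ^^ k) f = 0", OF K] by blast
  then show ?thesis using that by blast
qed

lemma of_nat_mpoly_eq_0_iff [simp]: "(of_nat k :: 'k::field_char_0 mpoly) = 0 \<longleftrightarrow> k = 0"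
  by (simp add: const_of_nat[symmetric])

lemma indet_neq_0 [simp]: "indet i \<noteq> (0 :: 'k::zero_neq_one mpoly)"
  by (metis indet_def lookup_single_eq lookup_zero zero_neq_one)

lemma kernel_Gamma: "Delta n f = 0 \<Longrightarrow> Delta n (Gamma n a f) = 0"
  by (simp add: Delta_Gamma)

lemma kernel_binom_op: "Delta n f = 0 \<Longrightarrow> Delta n (binom_op (Gamma n a) k f) = 0"
  using funpow_Delta_binom_op[of 1 n f a k] by simp

text \<open>The factors \<open>binom_op (Gamma n a) i V\<close> lie in the kernel of
  \<open>Delta\<close> and behave as constants, so \<open>Delta\<close> only acts on
  \<open>w\<close>; the terms with \<open>i \<ge> 2\<close> die.\<close>

lemma funpow_Delta_star_kernel:
  fixes w V :: "'k::field_char_0 mpoly"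
  assumes V: "Delta n V = 0" and w: "(Delta n ^^ Suc (Suc k)) w = 0"
  shows "(Delta n ^^ k) (star n a w V) = (Delta n ^^ k) w * V + (Delta n ^^ Suc k) w * Gamma n a V"
proof -
  have "(Delta n ^^ k) (star n a w V) =
      (\<Sum>i<Suc (Suc k). (Delta n ^^ k) ((Delta n ^^ i) w * binom_op (Gamma n a) i V))"
    unfolding star_eq_sum[OF w] by (rule Delta.funpow_sum)
  also have "\<dots> = (\<Sum>i<Suc (Suc k). (Delta n ^^ (k + i)) w * binom_op (Gamma n a) i V)"
    by (simp add: mult.commute[of _ "binom_op _ _ _"] Delta.funpow_times[OF kernel_binom_op[OF V]] funpow_add
        del: sum.lessThan_Suc)
  also have "\<dots> = (\<Sum>i\<in>{0, 1}. (Delta n ^^ (k + i)) w * binom_op (Gamma n a) i V)"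
    using Delta.funpow_eq_0_mono[OF w] by (intro sum.mono_neutral_right) auto
  finally show ?thesis by simp
qed

text \<open>Comparing orders of nilpotency forces \<open>Delta n U = 0\<close>; the top coefficient
  then gives \<open>U = indet 0\<close>, and the next one contradicts
  \<open>a \<noteq> 0\<close>.\<close>

lemma kernel_if_star_eq:
  fixes Z :: "'k::field_char_0 mpoly"
  assumes "a \<noteq> 0" "star n a Z U = indet 0 * Z"
  shows "Delta n Z = 0"
proof (rule ccontr)
  assume Z: "Delta n Z \<noteq> 0"
  obtain M where M: "(Delta n ^^ M) (Delta n Z) \<noteq> 0" "(Delta n ^^ Suc M) (Delta n Z) = 0"
    by (rule Delta_order[OF Z])
  have M1: "(Delta n ^^ Suc M) Z \<noteq> 0"
    using M(1) by (simp add: funpow_swap1)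
  have M2: "(Delta n ^^ Suc (Suc M)) Z = 0"
    using M(2) by (simp add: funpow_swap1)
  have "Z \<noteq> 0" using Z by auto
  have "U \<noteq> 0"
  proof
    assume "U = 0"
    then have "star n a Z U = 0"
      using binom_op_eigenvector[of n a U 0] by (simp add: star_eq_sum[OF M2])
    then show False
      using assms(2) \<open>Z \<noteq> 0\<close> by simp
  qed
  then obtain N where N: "(Delta n ^^ N) U \<noteq> 0" "(Delta n ^^ Suc N) U = 0"
    by (rule Delta_order)
  have "N = 0"
  proof (rule ccontr)
    assume "N \<noteq> 0"
    \<comment> \<open>For \<open>i > 0\<close> the factor from \<open>Z\<close> has lost
      \<open>i\<close> orders and the other has gained none, so only the term \<open>i = 0\<close>
      reaches order \<open>Suc M + N\<close>.\<close>
    have vanish: "(Delta n ^^ (Suc M + N)) ((Delta n ^^ i) Z * binom_op (Gamma n a) i U) = 0"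
      if i: "i \<in> {..<Suc (Suc M)} - {0}" for i
    proof (rule Delta.funpow_mult_eq_0)
      have "(Delta n ^^ (Suc (Suc M) - i + i)) Z = 0"
        using i M2 by (simp del: funpow.simps)
      then show "(Delta n ^^ (Suc (Suc M) - i)) ((Delta n ^^ i) Z) = 0"
        by (simp only: funpow_add o_apply)
      show "(Delta n ^^ Suc N) (binom_op (Gamma n a) i U) = 0"
        by (rule funpow_Delta_binom_op[OF N(2)])
      show "Suc (Suc M) - i + Suc N \<le> Suc (Suc M + N)"
        using i by auto
    qed
    have "(Delta n ^^ (Suc M + N)) (star n a Z U) =
        (\<Sum>i<Suc (Suc M). (Delta n ^^ (Suc M + N)) ((Delta n ^^ i) Z * binom_op (Gamma n a) i U))"
      unfolding star_eq_sum[OF M2] by (rule Delta.funpow_sum)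
    also have "\<dots> =
        (\<Sum>i\<in>{0}. (Delta n ^^ (Suc M + N)) ((Delta n ^^ i) Z * binom_op (Gamma n a) i U))"
      using vanish by (intro sum.mono_neutral_right) auto
    also have "\<dots> = of_nat ((Suc M + N) choose Suc M) * (Delta n ^^ Suc M) Z * (Delta n ^^ N) U"
      using Delta.funpow_mult_top[OF M2 N(2)] by simp
    \<comment> \<open>The binomial coefficient is nonzero in characteristic zero. But
      \<open>indet 0 * Z\<close> has the order of \<open>Z\<close>, which is too small when
      \<open>N > 0\<close>.\<close>
    finally have "(Delta n ^^ (Suc M + N)) (indet 0 * Z) \<noteq> 0"
      using M1 N(1) by (simp add: assms(2) del: funpow.simps binomial_Suc_Suc)
    moreover have "(Delta n ^^ (Suc M + N)) Z = 0"
      using \<open>N \<noteq> 0\<close> by (intro Delta.funpow_eq_0_mono[OF M2]) simp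
    ultimately show False
      by (simp add: Delta.funpow_times del: funpow.simps)
  qed
  then have U: "Delta n U = 0" using N(2) by simp
  \<comment> \<open>At exponent \<open>Suc M\<close> the \<open>Gamma\<close> term drops out, which
    determines \<open>U\<close>.\<close>
  have "(Delta n ^^ Suc (Suc (Suc M))) Z = 0"
    by (rule Delta.funpow_eq_0_mono[OF M2]) simp
  from funpow_Delta_star_kernel[OF U this, of a]
  have "indet 0 * (Delta n ^^ Suc M) Z = (Delta n ^^ Suc M) Z * U"
    unfolding M2 by (simp add: assms(2) Delta.funpow_times del: funpow.simps)
  then have "U = indet 0"
    using M1 by (simp del: funpow.simps)
  then have "star n a Z (indet 0) = indet 0 * Z" using assms(2) by simp
  \<comment> \<open>At exponent \<open>M\<close> the ordinary products cancel and only the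
    \<open>Gamma\<close> term is left.\<close>
  with funpow_Delta_star_kernel[OF Delta_indet_0 M2, of a]
  have "(Delta n ^^ Suc M) Z * (const a * indet 0) = 0"
    by (simp add: Delta.funpow_times Gamma_indet del: funpow.simps)
  then show False
    using M1 \<open>a \<noteq> 0\<close> by (simp del: funpow.simps)
qed

text \<open>\<open>w\<close> outlives \<open>E\<close> by at most one step: otherwise the last
  nonzero iterate of \<open>w\<close>, times \<open>Gamma n a Z\<close>, would be the only
  uncancelled term.\<close>

lemma funpow_Delta_eq_0_if_star_eq:
  fixes Z :: "'k::field_char_0 mpoly"
  assumes Z: "Delta n Z = 0" "Gamma n a Z \<noteq> 0"
    and w: "star n a w Z = Z * w + E" and E: "(Delta n ^^ r) E = 0"
  shows "(Delta n ^^ Suc r) w = 0"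
proof (rule ccontr)
  assume *: "(Delta n ^^ Suc r) w \<noteq> 0"
  obtain M where M: "(Delta n ^^ M) ((Delta n ^^ Suc r) w) \<noteq> 0"
      "(Delta n ^^ Suc M) ((Delta n ^^ Suc r) w) = 0"
    by (rule Delta_order[OF *])
  have *: "(Delta n ^^ k) ((Delta n ^^ Suc r) w) = (Delta n ^^ (Suc (k + r))) w" for k
    using funpow_add[of k "Suc r" "Delta n", THEN fun_cong, of w] by (simp only: o_apply add_Suc_right)
  have M1: "(Delta n ^^ Suc (M + r)) w \<noteq> 0"
    using M(1) by (simp only: * not_False_eq_True)
  have M2: "(Delta n ^^ Suc (Suc (M + r))) w = 0"
    using M(2) by (simp only: * add_Suc)
  have "(Delta n ^^ (M + r)) (Z * w + E) = Z * (Delta n ^^ (M + r)) w"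
    using Delta.funpow_eq_0_mono[OF E] by (simp add: Delta.funpow_add Delta.funpow_times[OF Z(1)])
  then have "(Delta n ^^ Suc (M + r)) w * Gamma n a Z = 0"
    using funpow_Delta_star_kernel[OF Z(1) M2, of a] by (simp add: w del: funpow.simps)
  then show False
    using M1 Z(2) by (simp del: funpow.simps)
qed

text \<open>The bracket is \<open>const a * indet 0 * Delta n Z\<close>, of order one below that of
  \<open>Z\<close>, whereas a nonzero multiple of \<open>Z\<close> has at least the order of
  \<open>Z\<close>.\<close>

lemma pbracket_kernel:
  fixes Z :: "'k::field_char_0 mpoly"
  assumes "a \<noteq> 0" "pbracket n a Z (indet 0) = Z * h"
  shows "Delta n Z = 0"
proof (rule ccontr)
  assume Z: "Delta n Z \<noteq> 0"
  obtain M where M: "(Delta n ^^ M) (Delta n Z) \<noteq> 0" "(Delta n ^^ Suc M) (Delta n Z) = 0"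
    by (rule Delta_order[OF Z])
  have M1: "(Delta n ^^ Suc M) Z \<noteq> 0"
    using M(1) by (simp add: funpow_swap1)
  have M2: "(Delta n ^^ Suc (Suc M)) Z = 0"
    using M(2) by (simp add: funpow_swap1)
  have eq: "const a * (indet 0 * Delta n Z) = Z * h"
    using assms(2) by (simp add: pbracket_def Gamma_indet ac_simps)
  have "h \<noteq> 0"
    using eq Z \<open>a \<noteq> 0\<close> by auto
  then obtain N where N: "(Delta n ^^ N) h \<noteq> 0" "(Delta n ^^ Suc N) h = 0"
    by (rule Delta_order)
  have "(Delta n ^^ (Suc M + N)) (Z * h) \<noteq> 0"
    unfolding Delta.funpow_mult_top[OF M2 N(2)]
    using M1 N(1) by (simp del: funpow.simps binomial_Suc_Suc)
  moreover have "(Delta n ^^ (Suc M + N)) (Delta n Z) = 0"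
    by (rule Delta.funpow_eq_0_mono[OF M(2)]) simp
  ultimately show False
    unfolding eq[symmetric]
    by (simp add: Delta.funpow_const_times Delta.funpow_times del: funpow.simps)
qed

text \<open>
  \<open>K\<close>, \<open>H\<close> and \<open>H'\<close> collect the correction terms of the star product; they vanish in the Poisson case.
\<close>

lemma parameter_unique:
  fixes Z F G :: "'k::field_char_0 mpoly"
  assumes "n \<ge> 2" "a \<noteq> 0" "a' \<noteq> 0"
    and Z: "Delta n Z = 0" "lin_coeff 0 Z \<noteq> 0"
    and FZ: "Delta n F * Gamma n a' Z = const a * (Z * Z)"
    and GZ: "Delta n G * Gamma n a' Z + Delta n (Delta n G) * K = const a * (Z * F) + const b * (Z * Z)"
    and K: "const_coeff K = 0" "Delta n K = 0"
    and nil: "Delta n (Delta n F) = 0" "Delta n (Delta n (Delta n G)) = 0"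
    and GF: "Delta n G * Gamma n a' F - Delta n F * Gamma n a' G + Delta n (Delta n G) * H =
      const (a + 1) * (F * F + Delta n F * H') - const (a + 2) * (Z * G) + const c * (Z * F)"
    and H: "const_coeff H = 0" "const_coeff H' = 0"
  shows "a = a'"
proof -
  have n: "0 < n" "1 < n" using \<open>n \<ge> 2\<close> by auto
  define l where "l = lin_coeff 0 Z"
  have Z0: "const_coeff Z = 0"
    using arg_cong[OF FZ, of const_coeff] \<open>a \<noteq> 0\<close> by simp
  have lin_Z: "lin_coeff (Suc 0) Z = 0"
    using lin_coeff_Delta[of 0 n Z] n Z by simp
  have lin_Delta: "lin_coeff 0 (Delta n f) = lin_coeff 1 f" "lin_coeff 1 (Delta n f) = lin_coeff 2 f" for f
    using lin_coeff_Delta[of 0 n f] lin_coeff_Delta[of 1 n f] n by (simp_all add: numeral_2_eq_2)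
  \<comment> \<open>\<open>Delta\<close> shifts linear coefficients down by one index, so this is
    the coefficient at 0 of \<open>Delta n (Delta n F)\<close>.\<close>
  have lin_F: "lin_coeff 2 F = 0"
    using lin_Delta(2)[of F] lin_Delta(1)[of "Delta n F"] by (simp add: nil)
  have lin_G: "lin_coeff 2 (Delta n G) = 0"
    using lin_Delta(2)[of "Delta n G"] lin_Delta(1)[of "Delta n (Delta n G)"] by (simp add: nil)
  have lin_Gamma: "lin_coeff 0 (Gamma n a' f) = a' * lin_coeff 0 f"
      "lin_coeff 1 (Gamma n a' f) = (a' + 1) * lin_coeff 1 f" for f
    using lin_coeff_Gamma[of 0 n a' f] lin_coeff_Gamma[of 1 n a' f] n by simp_all
  note simps = lookup_numeral pdiff_mult pdiff.add pdiff.diff lookup_add lookup_minus lin_Delta[unfolded One_nat_def] lin_Gamma[unfolded One_nat_def] Z0 H K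
  \<comment> \<open>Differentiating twice at the origin extracts twice the coefficient of the
    square; for factors vanishing there, only products of linear coefficients remain.\<close>
  have "lin_coeff 1 F * (a' * l) = a * (l * l)"
    using arg_cong[OF FZ, of "\<lambda>f. const_coeff (pdiff 0 (pdiff 0 f))"] by (simp add: simps l_def)
  then have F1: "a' * lin_coeff 1 F = a * l"
    using Z(2) by (simp add: l_def mult.commute)
  have F0: "const_coeff F = 0"
    using arg_cong[OF GZ, of "lin_coeff 0"] Z(2) \<open>a \<noteq> 0\<close> by (simp add: simps)
  \<comment> \<open>Applying \<open>Delta\<close> to \<open>GZ\<close> removes the \<open>K\<close>
    and \<open>b\<close> terms.\<close>
  have "Delta n (Delta n G) * Gamma n a' Z = const a * (Z * Delta n F)"
    using arg_cong[OF GZ, of "Delta n"]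
    by (simp add: Delta.add Delta.mult Z nil kernel_Gamma K)
  from arg_cong[OF this, of "\<lambda>f. const_coeff (pdiff 0 (pdiff 0 f))"]
  have "lin_coeff 2 G * (a' * l) = a * (l * lin_coeff 1 F)"
    by (simp add: simps l_def mult.commute)
  then have G2: "a' * lin_coeff 2 G = a * lin_coeff 1 F"
    using Z(2) by (simp add: l_def mult.commute)
  \<comment> \<open>Only the product \<open>(a + 2) * const_coeff G\<close> is shown to vanish,
    which also covers \<open>a = - 2\<close>; it disposes of the second derivative of
    \<open>Z\<close> in the next equation.\<close>
  have G0: "(a + 2) * const_coeff G = 0"
    using arg_cong[OF GF, of "lin_coeff 0"] Z(2) by (simp add: simps F0)
  have "2 * (lin_coeff 2 G * ((a' + 1) * lin_coeff 1 F)) =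
      (a + 1) * (2 * (lin_coeff 1 F * lin_coeff 1 F)) - (a + 2) * const_coeff G * const_coeff (pdiff 1 (pdiff 1 Z))"
    using arg_cong[OF GF, of "\<lambda>f. const_coeff (pdiff 1 (pdiff 1 f))"] n
    by (simp add: simps F0 lin_F lin_G lin_Z algebra_simps)
  then have "(2 * lin_coeff 1 F) * (lin_coeff 2 G * (a' + 1)) = (2 * lin_coeff 1 F) * ((a + 1) * lin_coeff 1 F)"
    unfolding G0 by (simp add: ac_simps)
  moreover have F1_neq: "lin_coeff 1 F \<noteq> 0"
    using F1 Z(2) \<open>a \<noteq> 0\<close> by (auto simp: l_def)
  ultimately have "lin_coeff 2 G * (a' + 1) = (a + 1) * lin_coeff 1 F"
    by simp
  \<comment> \<open>Subtracting \<open>G2\<close> from this equation leaves the two coefficients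
    themselves.\<close>
  then have "lin_coeff 2 G = lin_coeff 1 F"
    using G2 by (simp add: algebra_simps)
  then show ?thesis
    using G2 F1_neq by simp
qed

section \<open>Rigidity of the parameter\<close>

text \<open>For \<open>Z\<close> in the kernel, the linear coefficient at \<open>Suc i\<close> is
  that of \<open>Delta n Z = 0\<close> at \<open>i\<close>.\<close>

lemma lin_coeff_0_neq_0:
  assumes "Delta n Z = 0" "\<exists>j\<le>n. lin_coeff j Z \<noteq> 0"
  shows "lin_coeff 0 Z \<noteq> 0"
proof -
  obtain j where j: "j \<le> n" "lin_coeff j Z \<noteq> 0" using assms(2) by blast
  have "j = 0"
  proof (rule ccontr)
    assume "j \<noteq> 0"
    then obtain i where "j = Suc i" by (cases j) auto
    then show False using j lin_coeff_Delta[of i n Z] assms(1) by simp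
  qed
  then show ?thesis using j by simp
qed

lemma Gamma_neq_0: "a \<noteq> 0 \<Longrightarrow> lin_coeff 0 f \<noteq> (0 :: 'k::idom) \<Longrightarrow> Gamma n a f \<noteq> 0"
  using lin_coeff_Gamma[of 0 n a f] by auto

lemma star_indet_1:
  assumes "n \<ge> 1"
  shows "star n a (indet 1) g = indet 1 * g + indet 0 * Gamma n a g"
  using star_indet[OF assms, of a g] by simp

lemma star_indet_2:
  assumes "n \<ge> 2"
  shows "star n a (indet 2) g =
    indet 2 * g + indet 1 * Gamma n a g + indet 0 * binom_op (Gamma n a) 2 g"
  using star_indet[OF assms, of a g] by (simp add: numeral_2_eq_2 add.assoc)

text \<open>Normality of \<open>indet 0\<close>: it is a \<open>Gamma\<close> eigenvector for
  \<open>a\<close>, so it factors out of every term of the product.\<close>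

lemma star_indet_0_right:
  assumes "f \<in> polys n"
  obtains u where "u \<in> polys n" "star n a f (indet 0) = star n a (indet 0) u"
proof -
  obtain N where N: "(Delta n ^^ N) f = 0"
    using Delta_locally_nilpotent[of n f] by blast
  define u where "u = (\<Sum>k<N. const (a gchoose k) * (Delta n ^^ k) f)"
  have "Gamma n a (indet 0) = const a * indet 0" by (simp add: Gamma_indet)
  from binom_op_eigenvector[OF this] have "star n a f (indet 0) = star n a (indet 0) u"
    by (simp add: u_def star_kernel star_eq_sum[OF N] sum_distrib_left ac_simps)
  moreover have "u \<in> polys n"
    unfolding u_def using assms by (intro polys_sum polys_mult polys_const polys_funpow_Delta)
  ultimately show thesis by (rule that[rotated])
qed

lemma R_alg_iso_parameter:
  fixes a a' :: "'k::field_char_0"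
  assumes n: "n \<ge> 2" and a': "a' \<noteq> 0" and \<phi>: "\<phi> \<in> algebra_iso (R_alg n a) (R_alg n a')"
  shows "a = a'"
proof -
  have n1: "n \<ge> 1" using n by simp
  have \<phi>_add: "\<phi> (f + g) = \<phi> f + \<phi> g" if "f \<in> polys n" "g \<in> polys n" for f g
    using \<phi> that by (simp add: algebra_iso_def ring_iso_def ring_hom_def R_alg_def)
  have \<phi>_smult: "\<phi> (const c * f) = const c * \<phi> f" if "f \<in> polys n" for c f
    using \<phi> that by (simp add: algebra_iso_def R_alg_def)
  have \<phi>_star: "\<phi> (star n a f g) = star n a' (\<phi> f) (\<phi> g)" if "f \<in> polys n" "g \<in> polys n" for f g
    using \<phi> that by (simp add: algebra_iso_def ring_iso_def ring_hom_def R_alg_def)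
  have \<phi>_1: "\<phi> 1 = 1"
    using \<phi> by (simp add: algebra_iso_def ring_iso_def ring_hom_def R_alg_def)
  have \<phi>_bij: "bij_betw \<phi> (polys n) (polys n)"
    using \<phi> by (simp add: algebra_iso_def ring_iso_def R_alg_def)
  define X0 X1 X2 :: "'k mpoly" where "X0 = indet 0" and "X1 = indet 1" and "X2 = indet 2"
  define Z F G where "Z = \<phi> X0" and "F = \<phi> X1" and "G = \<phi> X2"
  have X: "X0 \<in> polys n" "X1 \<in> polys n" "X2 \<in> polys n"
    using n by (simp_all add: X0_def X1_def X2_def)
  have Gamma_X: "Gamma n a X0 = const a * X0" "Gamma n a X1 = const (a + 1) * X1"
      "Gamma n a X2 = const (a + 2) * X2"
    using Gamma_indet[of 0 n a] Gamma_indet[of 1 n a] Gamma_indet[of 2 n a] n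
    by (simp_all add: X0_def X1_def X2_def)
  note binom_X = Gamma_X[THEN binom_op_eigenvector]
  have star_X0: "star n a X0 g = X0 * g" for g
    by (simp add: star_kernel X0_def)
  note star_X1 = star_indet_1[OF n1, of a, folded X0_def X1_def]
  note star_X2 = star_indet_2[OF n, of a, folded X0_def X1_def X2_def]

  \<comment> \<open>The preimage \<open>y\<close> of the target's \<open>indet 0\<close> transports
    the normality of \<open>X0\<close> into an equation between \<open>Z\<close> and
    \<open>indet 0\<close>.\<close>
  obtain y where y: "y \<in> polys n" "\<phi> y = indet 0"
    using bij_betw_imp_surj_on[OF \<phi>_bij] polys_indet[of 0 n] by (metis image_iff le0)
  obtain u where u: "u \<in> polys n" "star n a y X0 = star n a X0 u"
    unfolding X0_def by (rule star_indet_0_right[OF y(1)])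
  have "star n a' Z (\<phi> u) = star n a' (indet 0) Z"
    using \<phi>_star[OF y(1) X(1)] \<phi>_star[OF X(1) u(1)] u(2) y(2) by (simp add: Z_def)
  then have ker: "Delta n Z = 0"
    by (intro kernel_if_star_eq[OF a', of n Z "\<phi> u"]) (simp add: star_kernel)
  then have star_Z: "star n a' Z f = Z * f" for f
    by (rule star_kernel)

  have "\<exists>j\<le>n. lin_coeff j (\<phi> (indet 0)) \<noteq> 0"
  proof (rule lin_coeff_image_indet_0[where mul = "star n a" and mul' = "star n a'"])
    fix P :: "'k mpoly \<Rightarrow> bool" and f :: "'k mpoly"
    assume "f \<in> polys n" "P 1"
      "\<And>f g. f \<in> polys n \<Longrightarrow> g \<in> polys n \<Longrightarrow> P f \<Longrightarrow> P g \<Longrightarrow> P (f + g)"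
      "\<And>c f. f \<in> polys n \<Longrightarrow> P f \<Longrightarrow> P (const c * f)"
      "\<And>i f. i \<le> n \<Longrightarrow> f \<in> polys n \<Longrightarrow> P f \<Longrightarrow> P (star n a (indet i) f)"
    then show "P f" by (rule polys_star_induct)
  qed (use \<phi>_add \<phi>_smult \<phi>_star \<phi>_1 \<phi>_bij in \<open>auto simp: lin_coeff_star bij_betw_def\<close>)
  then have lin_Z: "lin_coeff 0 Z \<noteq> 0"
    by (intro lin_coeff_0_neq_0[OF ker]) (simp add: Z_def X0_def)
  then have Gamma_Z: "Gamma n a' Z \<noteq> 0"
    by (rule Gamma_neq_0[OF a'])

  \<comment> \<open>Reordering relations among the first three generators, written purely in
    \<open>star\<close> so that \<open>\<phi>\<close> carries them to \<open>Z\<close>,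
    \<open>F\<close>, \<open>G\<close>.\<close>
  have "star n a X1 X0 = star n a X0 X1 + const a * star n a X0 X0"
    unfolding star_X0 star_X1 Gamma_X by (simp add: algebra_simps)
  then have FZ: "star n a' F Z = Z * F + const a * (Z * Z)"
    using X by (simp add: F_def Z_def \<phi>_add \<phi>_smult \<phi>_star[symmetric] polys_star polys_mult star_Z[unfolded Z_def, symmetric])
  have "star n a X2 X0 = star n a X0 X2 + (const a * star n a X0 X1 + const (a gchoose 2) * star n a X0 X0)"
    unfolding star_X0 star_X2 Gamma_X binom_X by (simp add: algebra_simps)
  then have GZ: "star n a' G Z = Z * G + (const a * (Z * F) + const (a gchoose 2) * (Z * Z))"
    using X by (simp add: F_def G_def Z_def \<phi>_add \<phi>_smult \<phi>_star[symmetric] polys_star polys_mult polys_add star_Z[unfolded Z_def, symmetric])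
  have "star n a X2 X1 + (const (a + 2) * star n a X0 X2 + const ((a + 1) * (a + 1)) * star n a X0 X1) =
      star n a X1 X2 + (const (a + 1) * star n a X1 X1 + const (a + 1 gchoose 2) * star n a X0 X1)"
    unfolding star_X0 star_X1 star_X2 Gamma_X binom_X const_mult by (simp add: algebra_simps)
  from arg_cong[OF this, of \<phi>]
  have GF: "star n a' G F + (const (a + 2) * (Z * G) + const ((a + 1) * (a + 1)) * (Z * F)) =
      star n a' F G + (const (a + 1) * star n a' F F + const (a + 1 gchoose 2) * (Z * F))"
    using X by (simp add: F_def G_def Z_def \<phi>_add \<phi>_smult \<phi>_star polys_star polys_mult polys_add star_Z[unfolded Z_def])

  \<comment> \<open>The commutator of \<open>F\<close> with \<open>Z\<close> is killed by one
    \<open>Delta\<close>, so \<open>F\<close> by two; that of \<open>G\<close> is then killed by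
    two, so \<open>G\<close> by three.\<close>
  have "(Delta n ^^ Suc 1) F = 0"
    by (rule funpow_Delta_eq_0_if_star_eq[OF ker Gamma_Z FZ]) (simp add: Delta.mult ker)
  then have F2: "Delta n (Delta n F) = 0" by simp
  have "(Delta n ^^ Suc 2) G = 0"
    by (rule funpow_Delta_eq_0_if_star_eq[OF ker Gamma_Z GZ])
      (simp add: numeral_2_eq_2 Delta.add Delta.mult ker F2)
  then have G3: "Delta n (Delta n (Delta n G)) = 0" by (simp add: numeral_2_eq_2)
  have star_F: "star n a' F g = F * g + Delta n F * Gamma n a' g" for g
    using star_eq_sum[of 2 n F a' g] F2 by (simp add: numeral_2_eq_2)
  have star_G: "star n a' G g = G * g + Delta n G * Gamma n a' g +
      Delta n (Delta n G) * binom_op (Gamma n a') 2 g" for g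
    using star_eq_sum[of 3 n G a' g] G3 by (simp add: numeral_3_eq_3 numeral_2_eq_2)

  \<comment> \<open>For \<open>a = 0\<close> the element \<open>X0\<close> is central, hence so is
    \<open>Z\<close>; commuting with \<open>indet 1\<close> forces
    \<open>Gamma n a' Z = 0\<close>.\<close>
  have "a \<noteq> 0"
  proof
    assume "a = 0"
    obtain w where w: "w \<in> polys n" "\<phi> w = indet 1"
      using bij_betw_imp_surj_on[OF \<phi>_bij] polys_indet[OF n1] by (metis image_iff)
    obtain N where N: "(Delta n ^^ Suc N) w = 0"
      using Delta_locally_nilpotent[of n w] by (metis le_SucI order_refl)
    have "binom_op (Gamma n a) k X0 = const (0 gchoose k) * X0" for k
      using binom_X(1) \<open>a = 0\<close> by simp
    then have "star n a w X0 = star n a X0 w"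
      unfolding star_X0 star_eq_sum[OF N]
      by (subst sum.lessThan_Suc_shift) (simp add: ac_simps)
    then have "star n a' (indet 1) Z = star n a' Z (indet 1)"
      using \<phi>_star[OF w(1) X(1)] \<phi>_star[OF X(1) w(1)] w(2) by (simp add: Z_def)
    then have "Gamma n a' Z = 0"
      by (simp add: star_indet_1[OF n1, unfolded One_nat_def] star_Z mult.commute)
    then show False using Gamma_Z by simp
  qed
  then show ?thesis
  \<comment> \<open>The constant \<open>c\<close> gathers all multiples of \<open>Z * F\<close> in
    the relation \<open>GF\<close>.\<close>
  proof (rule parameter_unique[OF n _ a' ker lin_Z, where F = F and G = G
        and K = "binom_op (Gamma n a') 2 Z" and H = "binom_op (Gamma n a') 2 F" and H' = "Gamma n a' F"
        and b = "a gchoose 2" and c = "(a + 1 gchoose 2) - (a + 1) * (a + 1)"])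
    show "Delta n F * Gamma n a' Z = const a * (Z * Z)"
      using FZ by (simp add: star_F mult.commute)
    show "Delta n G * Gamma n a' Z + Delta n (Delta n G) * binom_op (Gamma n a') 2 Z =
        const a * (Z * F) + const (a gchoose 2) * (Z * Z)"
      using GZ by (simp add: star_G mult.commute)
    show "Delta n G * Gamma n a' F - Delta n F * Gamma n a' G +
        Delta n (Delta n G) * binom_op (Gamma n a') 2 F =
        const (a + 1) * (F * F + Delta n F * Gamma n a' F) - const (a + 2) * (Z * G) +
        const ((a + 1 gchoose 2) - (a + 1) * (a + 1)) * (Z * F)"
      using GF unfolding star_F star_G const_diff by (simp add: algebra_simps)
  qed (simp_all add: F2 G3 kernel_binom_op ker)
qed

lemma A_alg_iso_parameter:
  fixes a a' :: "'k::field_char_0"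
  assumes n: "n \<ge> 2" and a': "a' \<noteq> 0" and \<phi>: "\<phi> \<in> poisson_iso (A_alg n a) (A_alg n a')"
  shows "a = a'"
proof -
  have n1: "n \<ge> 1" using n by simp
  have \<phi>_add: "\<phi> (f + g) = \<phi> f + \<phi> g" if "f \<in> polys n" "g \<in> polys n" for f g
    using \<phi> that by (simp add: poisson_iso_def algebra_iso_def ring_iso_def ring_hom_def A_alg_def)
  have \<phi>_smult: "\<phi> (const c * f) = const c * \<phi> f" if "f \<in> polys n" for c f
    using \<phi> that by (simp add: poisson_iso_def algebra_iso_def A_alg_def)
  have \<phi>_mult: "\<phi> (f * g) = \<phi> f * \<phi> g" if "f \<in> polys n" "g \<in> polys n" for f g
    using \<phi> that by (simp add: poisson_iso_def algebra_iso_def ring_iso_def ring_hom_def A_alg_def)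
  have \<phi>_bracket: "\<phi> (pbracket n a f g) = pbracket n a' (\<phi> f) (\<phi> g)" if "f \<in> polys n" "g \<in> polys n" for f g
    using \<phi> that by (simp add: poisson_iso_def A_alg_def)
  have \<phi>_1: "\<phi> 1 = 1"
    using \<phi> by (simp add: poisson_iso_def algebra_iso_def ring_iso_def ring_hom_def A_alg_def)
  have \<phi>_const: "\<phi> (const c) = const c" for c
    using \<phi>_smult[OF polys_1, of c] \<phi>_1 by simp
  have \<phi>_bij: "bij_betw \<phi> (polys n) (polys n)"
    using \<phi> by (simp add: poisson_iso_def algebra_iso_def ring_iso_def A_alg_def)
  define X0 X1 X2 :: "'k mpoly" where "X0 = indet 0" and "X1 = indet 1" and "X2 = indet 2"
  define Z F G where "Z = \<phi> X0" and "F = \<phi> X1" and "G = \<phi> X2"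
  have X: "X0 \<in> polys n" "X1 \<in> polys n" "X2 \<in> polys n"
    using n by (simp_all add: X0_def X1_def X2_def)
  have Gamma_X: "Gamma n a X0 = const a * X0" "Gamma n a X1 = const (a + 1) * X1"
      "Gamma n a X2 = const (a + 2) * X2"
    using Gamma_indet[of 0 n a] Gamma_indet[of 1 n a] Gamma_indet[of 2 n a] n
    by (simp_all add: X0_def X1_def X2_def)
  have Delta_X: "Delta n X0 = 0" "Delta n X1 = X0" "Delta n X2 = X1"
    using Delta_indet[of n 1] Delta_indet[of n 2] n by (simp_all add: X0_def X1_def X2_def)

  \<comment> \<open>Bracketing with \<open>X0\<close> is \<open>- a * X0\<close> times
    \<open>Delta\<close>, so \<open>Z\<close> divides its bracket with every image; this is Poisson
    normality.\<close>
  have bracket_Z: "pbracket n a' Z (\<phi> f) = const (- a) * (Z * \<phi> (Delta n f))" if "f \<in> polys n" for f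
  proof -
    have "pbracket n a X0 f = const (- a) * (X0 * Delta n f)"
      using const_diff[of 0 a] by (simp add: pbracket_def Delta_X Gamma_X mult.assoc)
    then show ?thesis
      using \<phi>_bracket[OF X(1) that] that X(1)
      by (simp add: \<phi>_const \<phi>_mult polys_mult polys_Delta Z_def)
  qed
  obtain y where y: "y \<in> polys n" "\<phi> y = indet 0"
    using bij_betw_imp_surj_on[OF \<phi>_bij] polys_indet[of 0 n] by (metis image_iff le0)
  have "pbracket n a' Z (indet 0) = Z * (const (- a) * \<phi> (Delta n y))"
    using bracket_Z[OF y(1)] y(2) by (simp add: ac_simps)
  then have ker: "Delta n Z = 0"
    by (rule pbracket_kernel[OF a'])

  have "\<exists>j\<le>n. lin_coeff j (\<phi> (indet 0)) \<noteq> 0"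
  proof (rule lin_coeff_image_indet_0[where mul = "(*)" and mul' = "(*)"])
    fix P :: "'k mpoly \<Rightarrow> bool" and f :: "'k mpoly"
    assume "f \<in> polys n" "P 1"
      "\<And>f g. f \<in> polys n \<Longrightarrow> g \<in> polys n \<Longrightarrow> P f \<Longrightarrow> P g \<Longrightarrow> P (f + g)"
      "\<And>c f. f \<in> polys n \<Longrightarrow> P f \<Longrightarrow> P (const c * f)"
      "\<And>i f. i \<le> n \<Longrightarrow> f \<in> polys n \<Longrightarrow> P f \<Longrightarrow> P (indet i * f)"
    then show "P f" by (rule polys_induct)
  qed (use \<phi>_add \<phi>_smult \<phi>_mult \<phi>_1 \<phi>_bij in \<open>auto simp: pdiff_mult lookup_add bij_betw_def\<close>)
  then have lin_Z: "lin_coeff 0 Z \<noteq> 0"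
    by (intro lin_coeff_0_neq_0[OF ker]) (simp add: Z_def X0_def)
  then have Gamma_Z: "Gamma n a' Z \<noteq> 0"
    by (rule Gamma_neq_0[OF a'])

  \<comment> \<open>As \<open>Delta n Z = 0\<close>, the bracket with \<open>Z\<close> reduces to
    \<open>Gamma n a' Z\<close> times \<open>Delta\<close>, up to sign.\<close>
  have Gamma_Z_Delta: "Gamma n a' Z * Delta n (\<phi> f) = const a * (Z * \<phi> (Delta n f))" if "f \<in> polys n" for f
    using bracket_Z[OF that] const_diff[of 0 a] by (simp add: pbracket_def ker)
  have FZ: "Gamma n a' Z * Delta n F = const a * (Z * Z)"
    using Gamma_Z_Delta[OF X(2)] by (simp add: Delta_X F_def Z_def)
  have GZ: "Gamma n a' Z * Delta n G = const a * (Z * F)"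
    using Gamma_Z_Delta[OF X(3)] by (simp add: Delta_X F_def G_def)
  \<comment> \<open>\<open>Gamma n a' Z\<close> is nonzero and in the kernel of
    \<open>Delta\<close>, so it can be cancelled after differentiating.\<close>
  have F2: "Delta n (Delta n F) = 0"
    using arg_cong[OF FZ, of "Delta n"] Gamma_Z by (simp add: Delta.mult ker kernel_Gamma)
  have G3: "Delta n (Delta n (Delta n G)) = 0"
    using arg_cong[OF GZ, of "\<lambda>f. Delta n (Delta n f)"] Gamma_Z
    by (simp add: Delta.mult ker kernel_Gamma F2)
  have "pbracket n a X2 X1 = const (a + 1) * (X1 * X1) + const (- (a + 2)) * (X0 * X2)"
    using const_diff[of 0 "a + 2"] by (simp add: pbracket_def Delta_X Gamma_X algebra_simps)
  from arg_cong[OF this, of \<phi>]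
  have GF: "pbracket n a' G F = const (a + 1) * (F * F) + const (- (a + 2)) * (Z * G)"
    using X by (simp add: \<phi>_add \<phi>_const \<phi>_mult \<phi>_bracket polys_mult Z_def F_def G_def)

  have "a \<noteq> 0"
  proof
    assume "a = 0"
    obtain w where w: "w \<in> polys n" "\<phi> w = indet 1"
      using bij_betw_imp_surj_on[OF \<phi>_bij] polys_indet[OF n1] by (metis image_iff)
    show False
      using Gamma_Z_Delta[OF w(1)] w(2) \<open>a = 0\<close> n1 Gamma_Z by (simp add: Delta_indet)
  qed
  then show ?thesis
  proof (rule parameter_unique[OF n _ a' ker lin_Z, where F = F and G = G
        and K = 0 and H = 0 and H' = 0 and b = 0 and c = 0])
    show "Delta n F * Gamma n a' Z = const a * (Z * Z)"
      using FZ by (simp add: mult.commute)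
    show "Delta n G * Gamma n a' Z + Delta n (Delta n G) * 0 = const a * (Z * F) + const 0 * (Z * Z)"
      using GZ by (simp add: mult.commute)
    show "Delta n G * Gamma n a' F - Delta n F * Gamma n a' G + Delta n (Delta n G) * 0 =
        const (a + 1) * (F * F + Delta n F * 0) - const (a + 2) * (Z * G) + const 0 * (Z * F)"
      using GF const_diff[of 0 "a + 2"] by (simp add: pbracket_def mult.commute)
  qed (simp_all add: F2 G3)
qed

section \<open>Inverse isomorphisms and the equivalence\<close>

lemma algebra_iso_inv_into:
  fixes R :: "('k, 'b, 'm) module_scheme" and S :: "('k, 'c, 'n) module_scheme"
  assumes h: "h \<in> algebra_iso R S"
    and closed: "\<one>\<^bsub>R\<^esub> \<in> carrier R"
      "\<And>x y. x \<in> carrier R \<Longrightarrow> y \<in> carrier R \<Longrightarrow> x \<otimes>\<^bsub>R\<^esub> y \<in> carrier R"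
      "\<And>x y. x \<in> carrier R \<Longrightarrow> y \<in> carrier R \<Longrightarrow> x \<oplus>\<^bsub>R\<^esub> y \<in> carrier R"
      "\<And>c x. x \<in> carrier R \<Longrightarrow> c \<odot>\<^bsub>R\<^esub> x \<in> carrier R"
  shows "inv_into (carrier R) h \<in> algebra_iso S R"
proof -
  let ?g = "inv_into (carrier R) h"
  have bij: "bij_betw h (carrier R) (carrier S)"
    and mult: "\<And>x y. x \<in> carrier R \<Longrightarrow> y \<in> carrier R \<Longrightarrow> h (x \<otimes>\<^bsub>R\<^esub> y) = h x \<otimes>\<^bsub>S\<^esub> h y"
    and add: "\<And>x y. x \<in> carrier R \<Longrightarrow> y \<in> carrier R \<Longrightarrow> h (x \<oplus>\<^bsub>R\<^esub> y) = h x \<oplus>\<^bsub>S\<^esub> h y"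
    and one: "h \<one>\<^bsub>R\<^esub> = \<one>\<^bsub>S\<^esub>"
    and smult: "\<And>c x. x \<in> carrier R \<Longrightarrow> h (c \<odot>\<^bsub>R\<^esub> x) = c \<odot>\<^bsub>S\<^esub> h x"
    using h by (auto simp: algebra_iso_def ring_iso_def ring_hom_def)
  have g: "?g x \<in> carrier R" "h (?g x) = x" if "x \<in> carrier S" for x
    using bij that by (auto simp: bij_betw_def inv_into_into f_inv_into_f)
  \<comment> \<open>Injectivity reduces each law for the inverse to that for \<open>h\<close>;
    \<open>closed\<close> keeps the candidate values in the carrier.\<close>
  have g_eqI: "?g x = y" if "y \<in> carrier R" "h y = x" for x y
    using bij that by (auto simp: bij_betw_def)
  have "?g \<in> ring_hom S R"
    by (rule ring_hom_memI) (auto intro!: g_eqI closed simp: mult add one g)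
  then show ?thesis
    using bij_betw_inv_into[OF bij]
    by (auto simp: algebra_iso_def ring_iso_def smult g intro!: g_eqI closed)
qed

lemma algebra_isomorphic_R_alg_sym:
  "algebra_isomorphic (R_alg n a) (R_alg n b) \<Longrightarrow> algebra_isomorphic (R_alg n b) (R_alg n a)"
proof -
  assume "algebra_isomorphic (R_alg n a) (R_alg n b)"
  then obtain h where h: "h \<in> algebra_iso (R_alg n a) (R_alg n b)"
    by (auto simp: algebra_isomorphic_def)
  have "inv_into (carrier (R_alg n a)) h \<in> algebra_iso (R_alg n b) (R_alg n a)"
    by (rule algebra_iso_inv_into[OF h]) (simp_all add: R_alg_def polys_star polys_add polys_mult)
  then show ?thesis by (auto simp: algebra_isomorphic_def)
qed

lemma poisson_isomorphic_A_alg_sym: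
  "poisson_isomorphic (A_alg n a) (A_alg n b) \<Longrightarrow> poisson_isomorphic (A_alg n b) (A_alg n a)"
proof -
  assume "poisson_isomorphic (A_alg n a) (A_alg n b)"
  then obtain h where h: "h \<in> poisson_iso (A_alg n a) (A_alg n b)"
    by (auto simp: poisson_isomorphic_def)
  let ?g = "inv_into (polys n) h"
  have bij: "bij_betw h (polys n) (polys n)"
    using h by (simp add: poisson_iso_def algebra_iso_def ring_iso_def A_alg_def)
  have bracket: "h (pbracket n a x y) = pbracket n b (h x) (h y)" if "x \<in> polys n" "y \<in> polys n" for x y
    using h that by (simp add: poisson_iso_def A_alg_def)
  have "?g (pbracket n b x y) = pbracket n a (?g x) (?g y)" if "x \<in> polys n" "y \<in> polys n" for x y
  proof (rule inv_into_f_eq)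
    have g: "?g x \<in> polys n" "?g y \<in> polys n" "h (?g x) = x" "h (?g y) = y"
      using bij that by (auto simp: bij_betw_def inv_into_into f_inv_into_f)
    then show "pbracket n a (?g x) (?g y) \<in> polys n" "h (pbracket n a (?g x) (?g y)) = pbracket n b x y"
      by (simp_all add: polys_pbracket bracket)
  qed (use bij in \<open>simp add: bij_betw_def\<close>)
  moreover have "inv_into (carrier (A_alg n a)) h \<in> algebra_iso (A_alg n b) (A_alg n a)"
    using h by (intro algebra_iso_inv_into) (simp_all add: poisson_iso_def A_alg_def polys_add polys_mult)
  ultimately have "?g \<in> poisson_iso (A_alg n b) (A_alg n a)"
    by (simp add: poisson_iso_def A_alg_def)
  then show ?thesis by (auto simp: poisson_isomorphic_def)
qed

theorem theorem5p1:
  fixes n :: nat and a a' :: "'k::field_char_0"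
  assumes "n \<ge> 2"
  shows "(a = a' \<longleftrightarrow> algebra_isomorphic (R_alg n a) (R_alg n a')) \<and>
         (a = a' \<longleftrightarrow> poisson_isomorphic (A_alg n a) (A_alg n a'))"
proof (intro conjI iffI)
  assume "a = a'"
  then have "id \<in> algebra_iso (R_alg n a) (R_alg n a')" "id \<in> poisson_iso (A_alg n a) (A_alg n a')"
    by (simp_all add: poisson_iso_def algebra_iso_def ring_iso_set_refl)
  then show "algebra_isomorphic (R_alg n a) (R_alg n a')" "poisson_isomorphic (A_alg n a) (A_alg n a')"
    by (auto simp: algebra_isomorphic_def poisson_isomorphic_def)
next
  assume iso: "algebra_isomorphic (R_alg n a) (R_alg n a')"
  show "a = a'"
  \<comment> \<open>Rigidity needs a nonzero target parameter. For \<open>a' = 0\<close> the inverse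
    isomorphism has target parameter \<open>a\<close>, and if that is 0 too, the claim is
    immediate.\<close>
  proof (cases "a' = 0")
    case True
    then show ?thesis
      using algebra_isomorphic_R_alg_sym[OF iso] R_alg_iso_parameter[OF assms]
      by (auto simp: algebra_isomorphic_def)
  next
    case False
    then show ?thesis
      using iso R_alg_iso_parameter[OF assms] by (auto simp: algebra_isomorphic_def)
  qed
next
  assume iso: "poisson_isomorphic (A_alg n a) (A_alg n a')"
  show "a = a'"
  proof (cases "a' = 0")
    case True
    then show ?thesis
      using poisson_isomorphic_A_alg_sym[OF iso] A_alg_iso_parameter[OF assms]
      by (auto simp: poisson_isomorphic_def)
  next
    case False
    then show ?thesis
      using iso A_alg_iso_parameter[OF assms] by (auto simp: poisson_isomorphic_def)
  qed
qed

end
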